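(* Let $G$ be a cactus with maximum degree $\Delta(G)=3$. If $G$ has no block isomorphic to the $5$-cycle $C_5$, then $\chi(G^2)=\operatorname{ch}(G^2)=4$. If $G$ has a block isomorphic to $C_5$, then $\chi(G^2)=\operatorname{ch}(G^2)=5$.
   Context: Graphs are finite and simple. A cactus is a connected graph in which every edge lies on at most one cycle; equivalently, every block (maximal $2$-connected subgraph, where a single bridge edge also counts as a block) is an edge or a cycle. The square $G^2$ of a graph $G$ has vertex set $V(G)$, with $uv\in E(G^2)$ if and only if $1\le d_G(u,v)\le 2$, where $d_G(u,v)$ is the distance in $G$. $\chi(H)$ is the chromatic number of $H$, and $\operatorname{ch}(H)$ is its choice (list-chromatic) number: the least $k$ such that for every assignment of lists $L(v)$ with $|L(v)|\ge k$ to the vertices of $H$ there is a proper coloring of $H$ in which each vertex $v$ receives a color from $L(v)$. *)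

theory Defs
  imports "Graph_Theory.Graph_Theory"
begin

text \<open>
  Finite simple graphs are modelled, as in the AFP entry Graph_Theory, by the locale
  \<^locale>\<open>graph\<close>: finite symmetric digraphs without loops and parallel arcs.  An undirected edge
  is thus a pair of antiparallel arcs, which have the same set of end vertices.
\<close>

definition edge_of :: "('a, 'b) pre_digraph \<Rightarrow> 'b \<Rightarrow> 'a set" where
  "edge_of G a = {tail G a, head G a}"

definition max_degree :: "('a, 'b) pre_digraph \<Rightarrow> nat" where
  "max_degree G = Max (out_degree G ` verts G)"

text \<open>
  The library notion \<^const>\<open>pre_digraph.cycle\<close> is the directed one, for which going back and forth
  along a single edge is a cycle of length 2; the length bound excludes these.  Distinct arc walks
  (other starting point or orientation) may describe the same cycle of the graph, so a cycle is
  represented by the set of its undirected edges, which determines it as a subgraph.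
\<close>
definition cycle_edges :: "('a, 'b) pre_digraph \<Rightarrow> 'a set set \<Rightarrow> bool" where
  "cycle_edges G C \<longleftrightarrow> (\<exists>p. pre_digraph.cycle G p \<and> 3 \<le> length p \<and> C = edge_of G ` set p)"

definition cactus :: "('a, 'b) pre_digraph \<Rightarrow> bool" where
  "cactus G \<longleftrightarrow> graph G \<and> Digraph_Component.connected G \<and>
    (\<forall>a \<in> arcs G. \<forall>C D. cycle_edges G C \<and> edge_of G a \<in> C \<and>
       cycle_edges G D \<and> edge_of G a \<in> D \<longrightarrow> C = D)"

definition two_connected :: "('a, 'b) pre_digraph \<Rightarrow> bool" where
  "two_connected G \<longleftrightarrow> graph G \<and> 3 \<le> card (verts G) \<and> Digraph_Component.connected G \<and>
    (\<forall>v \<in> verts G. Digraph_Component.connected (pre_digraph.del_vert G v))"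

definition bridge :: "('a, 'b) pre_digraph \<Rightarrow> 'b \<Rightarrow> bool" where
  "bridge G a \<longleftrightarrow> a \<in> arcs G \<and>
    \<not> tail G a \<rightarrow>\<^sup>*\<^bsub>G\<lparr>arcs := {b \<in> arcs G. edge_of G b \<noteq> edge_of G a}\<rparr>\<^esub> head G a"

definition block :: "('a, 'b) pre_digraph \<Rightarrow> ('a, 'b) pre_digraph \<Rightarrow> bool" where
  "block G B \<longleftrightarrow> pre_digraph.max_subgraph G two_connected B \<or>
    (\<exists>a. bridge G a \<and> B = G \<restriction> edge_of G a)"

definition cycle_graph :: "nat \<Rightarrow> nat pair_pre_digraph" where
  "cycle_graph n = \<lparr> pverts = {..<n},
     parcs = {(i, j). i < n \<and> j < n \<and> (j = Suc i mod n \<or> i = Suc j mod n)} \<rparr>"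

text \<open>The distance is \<open>\<infinity>\<close> if there is no walk between the two vertices.\<close>
definition distance :: "('a, 'b) pre_digraph \<Rightarrow> 'a \<Rightarrow> 'a \<Rightarrow> ereal" where
  "distance G u v = wf_digraph.\<mu> G (\<lambda>_. 1) u v"

definition graph_square :: "('a, 'b) pre_digraph \<Rightarrow> 'a pair_pre_digraph" where
  "graph_square G = \<lparr> pverts = verts G,
     parcs = {(u, v) \<in> verts G \<times> verts G. 1 \<le> distance G u v \<and> distance G u v \<le> 2} \<rparr>"

definition proper_coloring :: "('a, 'b) pre_digraph \<Rightarrow> ('a \<Rightarrow> nat) \<Rightarrow> bool" where
  "proper_coloring G c \<longleftrightarrow> (\<forall>a \<in> arcs G. c (tail G a) \<noteq> c (head G a))"

definition chromatic_number :: "('a, 'b) pre_digraph \<Rightarrow> nat" where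
  "chromatic_number G = (LEAST k. \<exists>c. c ` verts G \<subseteq> {..<k} \<and> proper_coloring G c)"

text \<open>
  Natural numbers suffice as colors: the lists are finite sets and only the finitely many colors
  in the lists of vertices of a finite graph matter.
\<close>
definition choosable :: "('a, 'b) pre_digraph \<Rightarrow> nat \<Rightarrow> bool" where
  "choosable G k \<longleftrightarrow> (\<forall>L :: 'a \<Rightarrow> nat set. (\<forall>v \<in> verts G. finite (L v) \<and> k \<le> card (L v)) \<longrightarrow>
     (\<exists>c. (\<forall>v \<in> verts G. c v \<in> L v) \<and> proper_coloring G c))"

definition choice_number :: "('a, 'b) pre_digraph \<Rightarrow> nat" where
  "choice_number G = (LEAST k. choosable G k)"

end

theory Submission
  imports Defs
begin

text \<open>
  The lower bounds come from cliques of the square: a vertex of degree 3 with its neighbours, or the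
  vertices of a 5-cycle.  For the upper bounds, colour the square along a growing set \<open>S\<close> of vertices
  that is ear-free, i.e. no path with interior outside \<open>S\<close> joins two different vertices of \<open>S\<close>.
  Let \<open>u\<close> in \<open>S\<close> be adjacent to \<open>w\<close> outside \<open>S\<close>.  If \<open>u w\<close> lies on no cycle, add \<open>w\<close>: only \<open>u\<close> and
  the at most two other neighbours of \<open>u\<close> block colours for \<open>w\<close>.  Otherwise add the whole cycle
  through \<open>u w\<close>, which meets \<open>S\<close> only in \<open>u\<close>: the two cycle neighbours of \<open>u\<close> lose at most two
  colours each, the two vertices at distance 2 from \<open>u\<close> on the cycle at most one, the others none, and
  lists of these sizes suffice unless the cycle is a 5-cycle and there are only 4 colours.
\<close>

section \<open>List colouring the square of a cycle with one coloured vertex\<close>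

lemma ex_color_avoiding:
  assumes "length bs < card A"
  obtains x where "x \<in> A" "x \<notin> set bs"
proof -
  have "card (set bs) < card A" using assms card_length[of bs] by linarith
  then have "\<not> A \<subseteq> set bs" using card_mono[of "set bs" A] by auto
  then show ?thesis using that by blast
qed

lemma card_Diff_set_list: "card A \<le> card (A - set bs) + length bs"
proof (cases "finite A")
  case True
  have "card A \<le> card ((A - set bs) \<union> set bs)" using True by (intro card_mono) auto
  also have "\<dots> \<le> card (A - set bs) + card (set bs)" by (rule card_Un_le)
  finally show ?thesis using card_length[of bs] by linarith
qed simp

text \<open>The conflict graph is \<open>K4\<close> without the edge \<open>a d\<close>. Greedy
  colouring falls one colour short at the last vertex, and one is always saved: by a colour common
  to \<open>A\<close> and \<open>D\<close>, by a colour of \<open>A\<close> or \<open>D\<close> that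
  \<open>B\<close> lacks, or, if \<open>A\<close> and \<open>D\<close> are disjoint parts of
  \<open>B\<close>, because \<open>B\<close> has four colours.\<close>

lemma diamond_coloring:
  fixes A B C D :: "'c set"
  assumes "2 \<le> card A" "3 \<le> card B" "3 \<le> card C" "2 \<le> card D"
  obtains a b c d where "a \<in> A" "b \<in> B" "c \<in> C" "d \<in> D"
    "a \<noteq> b" "a \<noteq> c" "b \<noteq> c" "b \<noteq> d" "c \<noteq> d"
proof -
  have fin: "finite A" "finite D"
    using assms by (auto intro: card_ge_0_finite)
  consider x where "x \<in> A" "x \<in> D" | x where "x \<in> A" "x \<notin> B" | x where "x \<in> D" "x \<notin> B"
    | "A \<inter> D = {}" "A \<union> D \<subseteq> B" by blast
  then show ?thesis
  proof cases
    case 1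
    obtain b where b: "b \<in> B" "b \<noteq> x" using ex_color_avoiding[of "[x]" B] assms by auto
    obtain c where "c \<in> C" "c \<noteq> x" "c \<noteq> b" using ex_color_avoiding[of "[x, b]" C] assms by auto
    then show ?thesis using that[of x b c x] 1 b by auto
  next
    case 2
    obtain d where d: "d \<in> D" using ex_color_avoiding[of "[]" D] assms by auto
    obtain c where c: "c \<in> C" "c \<noteq> x" "c \<noteq> d" using ex_color_avoiding[of "[x, d]" C] assms by auto
    obtain b where "b \<in> B" "b \<noteq> d" "b \<noteq> c" using ex_color_avoiding[of "[d, c]" B] assms by auto
    then show ?thesis using that[of x b c d] 2 c d by auto
  next
    case 3
    obtain a where a: "a \<in> A" using ex_color_avoiding[of "[]" A] assms by auto
    obtain c where c: "c \<in> C" "c \<noteq> x" "c \<noteq> a" using ex_color_avoiding[of "[x, a]" C] assms by auto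
    obtain b where "b \<in> B" "b \<noteq> a" "b \<noteq> c" using ex_color_avoiding[of "[a, c]" B] assms by auto
    then show ?thesis using that[of a b c x] 3 c a by auto
  next
    case 4
    have "finite B" using assms by (auto intro: card_ge_0_finite)
    then have B: "4 \<le> card B"
      using 4 assms card_mono[of B "A \<union> D"] card_Un_disjoint[of A D] fin by auto
    obtain a where a: "a \<in> A" using ex_color_avoiding[of "[]" A] assms by auto
    obtain d where d: "d \<in> D" using ex_color_avoiding[of "[]" D] assms by auto
    obtain c where c: "c \<in> C" "c \<noteq> a" "c \<noteq> d" using ex_color_avoiding[of "[a, d]" C] assms by auto
    obtain b where "b \<in> B" "b \<noteq> a" "b \<noteq> c" "b \<noteq> d" using ex_color_avoiding[of "[a, c, d]" B] B by auto
    then show ?thesis using that[of a b c d] c a d by auto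
  qed
qed

text \<open>Going round the three lists cyclically, unless all agree, some colour of one list is
  missing from the next; using it costs the next vertex nothing. If all agree, the excluded case
  leaves three colours.\<close>

lemma triangle_coloring:
  fixes A B C :: "'c set"
  assumes "2 \<le> card A" "2 \<le> card B" "2 \<le> card C" "\<not> (A = B \<and> B = C \<and> card C = 2)"
  obtains a b c where "a \<in> A" "b \<in> B" "c \<in> C" "a \<noteq> b" "a \<noteq> c" "b \<noteq> c"
proof -
  have *: "\<exists>x\<in>X. \<exists>y\<in>Y. \<exists>z\<in>Z. x \<noteq> y \<and> x \<noteq> z \<and> y \<noteq> z"
    if p: "2 \<le> card X" "2 \<le> card Y" "2 \<le> card Z" "x \<in> X" "x \<notin> Y" for x and X Y Z :: "'c set"
  proof -
    obtain z where z: "z \<in> Z" "z \<noteq> x" using ex_color_avoiding[of "[x]" Z] p by auto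
    obtain y where "y \<in> Y" "y \<noteq> z" using ex_color_avoiding[of "[z]" Y] p by auto
    with p(4,5) z show ?thesis by (intro bexI[of _ x] bexI[of _ y] bexI[of _ z]) auto
  qed
  consider x where "x \<in> A" "x \<notin> B" | x where "x \<in> B" "x \<notin> C" | x where "x \<in> C" "x \<notin> A"
    | "A = B" "B = C" by blast
  then show ?thesis
  proof cases
    case 1
    obtain a b c where "a \<in> A" "b \<in> B" "c \<in> C" "a \<noteq> b" "a \<noteq> c" "b \<noteq> c"
      using *[OF assms(1-3) 1] by blast
    then show ?thesis by (rule that)
  next
    case 2
    obtain b c a where "b \<in> B" "c \<in> C" "a \<in> A" "b \<noteq> c" "b \<noteq> a" "c \<noteq> a"
      using *[OF assms(2,3,1) 2] by blast
    then show ?thesis by (intro that[of a b c]) auto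
  next
    case 3
    obtain c a b where "c \<in> C" "a \<in> A" "b \<in> B" "c \<noteq> a" "c \<noteq> b" "a \<noteq> b"
      using *[OF assms(3,1,2) 3] by blast
    then show ?thesis by (intro that[of a b c]) auto
  next
    case 4
    then have c3: "3 \<le> card A" using assms by auto
    obtain a where a: "a \<in> A" using ex_color_avoiding[of "[]" A] c3 by auto
    obtain b where b: "b \<in> A" "b \<noteq> a" using ex_color_avoiding[of "[a]" A] c3 by auto
    obtain c where "c \<in> A" "c \<noteq> a" "c \<noteq> b" using ex_color_avoiding[of "[a, b]" A] c3 by auto
    with a b 4 show ?thesis by (intro that[of a b c]) auto
  qed
qed

text \<open>The letters are the vertices of a hexagon other than its coloured one, in order; only
  the opposite pairs \<open>a\<close>, \<open>d\<close> and \<open>b\<close>, \<open>e\<close> may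
  agree. If such a pair has a common colour, using it twice leaves at most three colours forbidden
  for \<open>c\<close>. Otherwise fix \<open>a\<close> and \<open>e\<close> and colour the triangle
  \<open>b\<close>, \<open>d\<close>, \<open>c\<close>; if that fails, another choice of
  \<open>a\<close> succeeds.\<close>

lemma hexagon_rest_coloring:
  fixes A B C D E :: "'c set"
  assumes "2 \<le> card A" "3 \<le> card B" "4 \<le> card C" "3 \<le> card D" "2 \<le> card E"
  obtains a b c d e where "a \<in> A" "b \<in> B" "c \<in> C" "d \<in> D" "e \<in> E"
    "distinct [a, b, c]" "distinct [b, c, d]" "distinct [c, d, e]" "a \<noteq> e"
proof -
  note colors = that
  have tri: thesis if ae: "a \<in> A" "e \<in> E" "a \<noteq> e"
    and n: "\<not> (B - {a} = D - {e} \<and> D - {e} = C - {a, e} \<and> card (C - {a, e}) = 2)" for a e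
  proof -
    have c: "2 \<le> card (B - {a})" "2 \<le> card (D - {e})" "2 \<le> card (C - {a, e})"
      using assms card_Diff_set_list[of B "[a]"] card_Diff_set_list[of D "[e]"]
        card_Diff_set_list[of C "[a, e]"] by auto
    obtain b d c where "b \<in> B - {a}" "d \<in> D - {e}" "c \<in> C - {a, e}" "b \<noteq> d" "b \<noteq> c" "d \<noteq> c"
      using triangle_coloring[OF c n] .
    with ae have "a \<in> A" "b \<in> B" "c \<in> C" "d \<in> D" "e \<in> E" "distinct [a, b, c]" "distinct [b, c, d]" "distinct [c, d, e]" "a \<noteq> e" by auto
      then show thesis by (rule colors)
  qed
  obtain e where e: "e \<in> E" using ex_color_avoiding[of "[]" E] assms by auto
  obtain a where a: "a \<in> A" "a \<noteq> e" using ex_color_avoiding[of "[e]" A] assms by auto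
  obtain a' where a': "a' \<in> A" "a' \<noteq> a" using ex_color_avoiding[of "[a]" A] assms by auto
  show thesis
  proof (cases "A \<inter> D = {} \<and> B \<inter> E = {}")
    case True
    show thesis
    proof (cases "B - {a} = D - {e} \<and> D - {e} = C - {a, e} \<and> card (C - {a, e}) = 2")
      case bad: True
      \<comment> \<open>Here the three reduced lists are one 2-set. So \<open>e\<close> lies in
        \<open>D\<close>, and \<open>a'\<close>, being outside \<open>D\<close>, differs from
        \<open>e\<close> and is missing from \<open>B\<close>. With \<open>a'\<close> in place of
        \<open>a\<close> the list of \<open>b\<close> keeps three colours and the obstruction
        disappears.\<close>
      have eq: "B - {a} = D - {e}" "card (D - {e}) = 2" using bad by auto
      have eD: "e \<in> D"
      proof (rule ccontr)
        assume "e \<notin> D"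
        then show False using assms(4) eq(2) by simp
      qed
      have a'D: "a' \<notin> D" using True a' by blast
      have ne: "a' \<noteq> e" using a'D eD by blast
      have a'B: "a' \<notin> B" using a'D a' eq(1) by blast
      show thesis
      proof (rule tri[OF a'(1) e ne])
        have "B - {a'} \<noteq> D - {e}"
        proof
          assume "B - {a'} = D - {e}"
          then have "card (B - {a'}) = 2" using eq(2) by simp
          then show False using assms(2) a'B by simp
        qed
        then show "\<not> (B - {a'} = D - {e} \<and> D - {e} = C - {a', e} \<and> card (C - {a', e}) = 2)"
          by simp
      qed
    next
      case False
      show thesis by (rule tri[OF a(1) e a(2) False])
    qed
  next
    case False
    then consider x where "x \<in> A" "x \<in> D" | x where "x \<in> B" "x \<in> E" by blast
    then show thesis
    proof cases
      case 1
      obtain e where e: "e \<in> E" "e \<noteq> x" using ex_color_avoiding[of "[x]" E] assms by auto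
      obtain b where b: "b \<in> B" "b \<noteq> x" using ex_color_avoiding[of "[x]" B] assms by auto
      obtain c where "c \<in> C" "c \<noteq> x" "c \<noteq> b" "c \<noteq> e"
        using ex_color_avoiding[of "[x, b, e]" C] assms by auto
      with 1 e b have "x \<in> A" "b \<in> B" "c \<in> C" "x \<in> D" "e \<in> E" "distinct [x, b, c]" "distinct [b, c, x]" "distinct [c, x, e]" "x \<noteq> e" by auto
      then show thesis by (rule colors)
    next
      case 2
      obtain a where a: "a \<in> A" "a \<noteq> x" using ex_color_avoiding[of "[x]" A] assms by auto
      obtain d where d: "d \<in> D" "d \<noteq> x" using ex_color_avoiding[of "[x]" D] assms by auto
      obtain c where "c \<in> C" "c \<noteq> x" "c \<noteq> d" "c \<noteq> a"
        using ex_color_avoiding[of "[x, d, a]" C] assms by auto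
      with 2 a d have "a \<in> A" "x \<in> B" "c \<in> C" "d \<in> D" "x \<in> E" "distinct [a, x, c]" "distinct [x, c, d]" "distinct [c, d, x]" "a \<noteq> x" by auto
      then show thesis by (rule colors)
    qed
  qed
qed

text \<open>Colouring backwards from \<open>m\<close>, whose colour is prescribed, each position
  meets at most two coloured ones, namely the next two.\<close>

lemma greedy_tail_coloring:
  fixes F :: "nat \<Rightarrow> 'c set"
  assumes "k \<le> m" "z \<in> F m" and F: "\<And>i. k \<le> i \<Longrightarrow> i < m \<Longrightarrow> 3 \<le> card (F i)"
  shows "\<exists>g. g m = z \<and> (\<forall>i. k \<le> i \<and> i \<le> m \<longrightarrow> g i \<in> F i) \<and>
    (\<forall>i j. k \<le> i \<and> i < j \<and> j \<le> m \<and> j \<le> i + 2 \<longrightarrow> g i \<noteq> g j)"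
  using assms(1)
proof (induction rule: inc_induct)
  case base
  show ?case by (rule exI[of _ "\<lambda>_. z"]) (use assms in auto)
next
  case (step k)
  then obtain g where g: "g m = z" "\<And>i. Suc k \<le> i \<Longrightarrow> i \<le> m \<Longrightarrow> g i \<in> F i"
    "\<And>i j. Suc k \<le> i \<Longrightarrow> i < j \<Longrightarrow> j \<le> m \<Longrightarrow> j \<le> i + 2 \<Longrightarrow> g i \<noteq> g j"
    by blast
  have "3 \<le> card (F k)" using F step by blast
  then obtain x where x: "x \<in> F k" "x \<noteq> g (k+1)" "x \<noteq> g (k+2)"
    using ex_color_avoiding[of "[g (k+1), g (k+2)]" "F k"] by auto
  have "(g(k := x)) i \<noteq> (g(k := x)) j" if ij: "k \<le> i" "i < j" "j \<le> m" "j \<le> i + 2" for i j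
  proof (cases "i = k")
    case True
    then have "j = k + 1 \<or> j = k + 2" using ij by auto
    then show ?thesis using True x by auto
  qed (use g ij in auto)
  moreover have "(g(k := x)) i \<in> F i" if "k \<le> i" "i \<le> m" for i
    using that g x by auto
  moreover have "(g(k := x)) m = z" using g step by auto
  ultimately show ?case by blast
qed

text \<open>Position \<open>i\<close> stands for the vertex \<open>i + 1\<close> steps after the
  coloured vertex on a cycle with \<open>m + 1\<close> vertices, and \<open>F i\<close> for what is
  left of its list; positions \<open>0\<close> and \<open>m - 1\<close> conflict because both
  neighbour the coloured vertex. Cycles with up to six vertices are treated one by one, longer ones
  by reduction to a diamond.\<close>

lemma cycle_rest_coloring:
  fixes F :: "nat \<Rightarrow> 'c set"
  assumes "4 \<le> K" "2 \<le> m" "m = 4 \<Longrightarrow> 5 \<le> K"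
    and F: "\<And>i. i < m \<Longrightarrow>
      (if i = 0 \<or> i = m - 1 then K - 2 else if i = 1 \<or> i = m - 2 then K - 1 else K) \<le> card (F i)"
  obtains g where "\<And>i. i < m \<Longrightarrow> g i \<in> F i"
    "\<And>i j. i < j \<Longrightarrow> j < m \<Longrightarrow> j \<le> i + 2 \<or> i = 0 \<and> j = m - 1 \<Longrightarrow> g i \<noteq> g j"
proof -
  consider "m = 2" | "m = 3" | "m = 4" | "m = 5" | "6 \<le> m" using assms(2) by linarith
  then show thesis
  proof cases
    case 1
    have "2 \<le> card (F 0)" "2 \<le> card (F 1)" using F[of 0] F[of 1] assms(1) 1 by auto
    note c = this
    obtain a where a: "a \<in> F 0" using ex_color_avoiding[of "[]" "F 0"] c by auto
    obtain b where "b \<in> F 1" "b \<noteq> a" using ex_color_avoiding[of "[a]" "F 1"] c by auto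
    with a show thesis
      by (intro that[of "\<lambda>i. [a, b] ! i"]) (auto simp: 1 less_Suc_eq numeral_eq_Suc)
  next
    case 2
    have c: "2 \<le> card (F 0)" "3 \<le> card (F 1)" "2 \<le> card (F 2)"
      using F[of 0] F[of 1] F[of 2] assms(1) 2 by auto
    obtain a where a: "a \<in> F 0" using ex_color_avoiding[of "[]" "F 0"] c by auto
    obtain d where d: "d \<in> F 2" "d \<noteq> a" using ex_color_avoiding[of "[a]" "F 2"] c by auto
    obtain b where b: "b \<in> F 1" "b \<noteq> a" "b \<noteq> d" using ex_color_avoiding[of "[a, d]" "F 1"] c by auto
    show thesis
      by (intro that[of "\<lambda>i. [a, b, d] ! i"]) (use a b d in \<open>auto simp: 2 less_Suc_eq numeral_eq_Suc\<close>)
  next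
    case 3
    \<comment> \<open>The four remaining vertices of a 5-cycle conflict pairwise; the greedy choice
      needs these sizes and hence \<open>K\<close> at least 5.\<close>
    have c: "3 \<le> card (F 0)" "4 \<le> card (F 1)" "4 \<le> card (F 2)" "3 \<le> card (F 3)"
      using F[of 0] F[of 1] F[of 2] F[of 3] assms(3) 3 by auto
    obtain a where a: "a \<in> F 0" using ex_color_avoiding[of "[]" "F 0"] c by auto
    obtain d where d: "d \<in> F 3" "d \<noteq> a" using ex_color_avoiding[of "[a]" "F 3"] c by auto
    obtain b where b: "b \<in> F 1" "b \<noteq> a" "b \<noteq> d" using ex_color_avoiding[of "[a, d]" "F 1"] c by auto
    obtain e where e: "e \<in> F 2" "e \<noteq> a" "e \<noteq> d" "e \<noteq> b"
      using ex_color_avoiding[of "[a, d, b]" "F 2"] c by auto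
    show thesis
      by (intro that[of "\<lambda>i. [a, b, e, d] ! i"])
        (use a b d e in \<open>auto simp: 3 less_Suc_eq numeral_eq_Suc\<close>)
  next
    case 4
    have c: "2 \<le> card (F 0)" "3 \<le> card (F 1)" "4 \<le> card (F 2)" "3 \<le> card (F 3)" "2 \<le> card (F 4)"
      using F[of 0] F[of 1] F[of 2] F[of 3] F[of 4] assms(1) 4 by auto
    obtain v w x y z where "v \<in> F 0" "w \<in> F 1" "x \<in> F 2" "y \<in> F 3" "z \<in> F 4"
      "distinct [v, w, x]" "distinct [w, x, y]" "distinct [x, y, z]" "v \<noteq> z"
      using hexagon_rest_coloring[OF c] by metis
    then show thesis
      by (intro that[of "\<lambda>i. [v, w, x, y, z] ! i"]) (auto simp: 4 less_Suc_eq numeral_eq_Suc)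
  next
    case 5
    obtain n where m: "m = n + 6" using 5 by (metis add.commute le_Suc_ex)
    have c: "2 \<le> card (F 0)" "3 \<le> card (F 1)" "4 \<le> card (F 2)" "4 \<le> card (F 3)" "2 \<le> card (F (m - 1))"
      using F[of 0] F[of 1] F[of 2] F[of 3] F[of "m - 1"] assms(1) by (simp_all add: m)
    have c6: "3 \<le> card (F i)" if "4 \<le> i" "i < m - 1" for i
      using F[of i] assms(1) that unfolding m by (auto split: if_splits)
    have c4: "4 \<le> card (F 4)" if "m \<noteq> 6"
      using F[of 4] assms(1) that by (simp add: m)
    \<comment> \<open>Both ends are coloured first, then the tail from position 5 on, backwards from
      \<open>m - 1\<close>. Positions 1 to 4 remain; only 1 and 4 are more than two apart, so their
      conflicts form a diamond.\<close>
    obtain a where a: "a \<in> F 0" using ex_color_avoiding[of "[]" "F 0"] c by auto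
    obtain z where z: "z \<in> F (m - 1)" "z \<noteq> a" using ex_color_avoiding[of "[a]" "F (m - 1)"] c by auto
    obtain g where g: "g (m - 1) = z" "\<And>i. 5 \<le> i \<Longrightarrow> i \<le> m - 1 \<Longrightarrow> g i \<in> F i"
      "\<And>i j. 5 \<le> i \<Longrightarrow> i < j \<Longrightarrow> j \<le> m - 1 \<Longrightarrow> j \<le> i + 2 \<Longrightarrow> g i \<noteq> g j"
      using greedy_tail_coloring[of 5 "m - 1" z F] c6 z 5 by force
    \<comment> \<open>Position 4 meets positions 5 and 6 of the tail. For \<open>m = 6\<close> there
      is no position 6, but then 4 is \<open>m - 2\<close> and its list may already be one
      shorter.\<close>
    define D where "D = (if m = 6 then F 4 - {g 5} else F 4 - {g 5, g 6})"
    have cd: "2 \<le> card (F 1 - {a})" "3 \<le> card (F 2 - {a})" "3 \<le> card (F 3 - {g 5})" "2 \<le> card D"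
      using c c4 c6[of 4] 5 card_Diff_set_list[of "F 1" "[a]"] card_Diff_set_list[of "F 2" "[a]"]
        card_Diff_set_list[of "F 3" "[g 5]"] card_Diff_set_list[of "F 4" "[g 5]"]
        card_Diff_set_list[of "F 4" "[g 5, g 6]"]
      by (auto simp: D_def)
    obtain v w x y where v: "v \<in> F 1 - {a}" "w \<in> F 2 - {a}" "x \<in> F 3 - {g 5}" "y \<in> D"
      "v \<noteq> w" "v \<noteq> x" "w \<noteq> x" "w \<noteq> y" "x \<noteq> y"
      using diamond_coloring[OF cd] by metis
    define h where "h i = (if i < 5 then [a, v, w, x, y] ! i else g i)" for i
    have h: "h 0 = a" "h 1 = v" "h 2 = w" "h 3 = x" "h 4 = y" "\<And>i. 5 \<le> i \<Longrightarrow> h i = g i"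
      by (auto simp: h_def)
    have lt5: "i = 0 \<or> i = 1 \<or> i = 2 \<or> i = 3 \<or> i = 4" if "i < 5" for i :: nat using that by auto
    show thesis
    proof (rule that[of h])
      fix i assume "i < m"
      then show "h i \<in> F i"
        using lt5[of i] h v a g(2)[of i] by (cases "i < 5") (auto simp: D_def split: if_splits)
    next
      fix i j assume ij: "i < j" "j < m" "j \<le> i + 2 \<or> i = 0 \<and> j = m - 1"
      show "h i \<noteq> h j"
      proof (cases "j < 5")
        case True
        then show ?thesis using lt5[of i] lt5[of j] ij h v 5 by auto
      next
        case False
        then have j: "h j = g j" "5 \<le> j" using h by auto
        show ?thesis
        proof (cases "i < 5")
          case True
          then consider "i = 0" "j = m - 1" | "i = 3" "j = 5" | "i = 4" "j = 5" | "i = 4" "j = 6"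
            using j ij by linarith
          then show ?thesis
          proof cases
            case 1
            then show ?thesis using j(1) h(1) g(1) z(2) by metis
          next
            case 2
            then show ?thesis using j(1) h(4) v(3) by auto
          next
            case 3
            then show ?thesis using j(1) h(5) v(4) by (auto simp: D_def split: if_splits)
          next
            case 4
            then show ?thesis using j(1) h(5) v(4) ij(2) by (auto simp: D_def split: if_splits)
          qed
        next
          case f: False
          then show ?thesis using g(3)[of i j] h(6)[of i] j ij by auto
        qed
      qed
    qed
  qed
qed

section \<open>Cycles and ears in a cactus\<close>

fun path_edges :: "'a list \<Rightarrow> 'a set set" where
  "path_edges (x # y # zs) = insert {x, y} (path_edges (y # zs))"
| "path_edges _ = {}"

text \<open>Vertex lists, without repeating the first vertex at the end, allow cycles to be rotated,
  cut and spliced; \<open>cyclic_arc_cycle\<close> leads back to arc walks. The length bound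
  excludes running back and forth along an edge.\<close>

definition cyclic :: "('a \<Rightarrow> 'a \<Rightarrow> bool) \<Rightarrow> 'a list \<Rightarrow> bool" where
  "cyclic adj c \<longleftrightarrow> distinct c \<and> 3 \<le> length c \<and> successively adj (c @ [hd c])"

definition cyclic_edges :: "'a list \<Rightarrow> 'a set set" where
  "cyclic_edges c = path_edges (c @ [hd c])"

lemma path_edges_append: "path_edges (xs @ x # ys) = path_edges (xs @ [x]) \<union> path_edges (x # ys)"
proof (induction xs)
  case (Cons z xs)
  then show ?case by (cases xs) auto
qed simp

lemma path_edges_Cons: "xs \<noteq> [] \<Longrightarrow> path_edges (x # xs) = insert {x, hd xs} (path_edges xs)"
  by (cases xs) auto

lemma path_edges_subset: "e \<in> path_edges xs \<Longrightarrow> e \<subseteq> set xs"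
  by (induction xs rule: path_edges.induct) auto

lemma path_edges_nth: "path_edges xs = {{xs ! i, xs ! Suc i} |i. Suc i < length xs}"
proof (induction xs rule: path_edges.induct)
  case (1 x y zs)
  have "{{(x # y # zs) ! i, (x # y # zs) ! Suc i} |i. Suc i < length (x # y # zs)}
    = insert {x, y} {{(y # zs) ! i, (y # zs) ! Suc i} |i. Suc i < length (y # zs)}"
    (is "?A = insert _ ?B")
  proof (intro equalityI subsetI)
    fix e assume "e \<in> ?A"
    then obtain i where i: "Suc i < length (x # y # zs)" "e = {(x # y # zs) ! i, (x # y # zs) ! Suc i}"
      by blast
    then show "e \<in> insert {x, y} ?B"
      by (cases i) auto
  next
    fix e assume "e \<in> insert {x, y} ?B"
    then consider "e = {x, y}" | i where "Suc i < length (y # zs)" "e = {(y # zs) ! i, (y # zs) ! Suc i}"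
      by blast
    then show "e \<in> ?A"
    proof cases
      case 1
      then show ?thesis by (intro CollectI exI[of _ 0]) auto
    next
      case 2
      then show ?thesis by (intro CollectI exI[of _ "Suc i"]) auto
    qed
  qed
  then show ?case using 1 by simp
qed auto

text \<open>Lets a cycle start at any of its vertices. Both edge sets consist of the same two paths
  between the old and the new starting vertex.\<close>

lemma cyclic_rotate:
  assumes "cyclic adj (xs @ y # ys)"
  shows "cyclic adj (y # ys @ xs)" "cyclic_edges (y # ys @ xs) = cyclic_edges (xs @ y # ys)"
proof -
  show "cyclic adj (y # ys @ xs)"
    using assms by (cases xs) (auto simp: cyclic_def successively_append_iff successively_Cons hd_append split: if_splits)
  show "cyclic_edges (y # ys @ xs) = cyclic_edges (xs @ y # ys)"
  proof (cases xs)
    case (Cons x xs')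
    have "cyclic_edges (xs @ y # ys) = path_edges (xs @ [y]) \<union> path_edges ((y # ys) @ [x])"
      unfolding cyclic_edges_def using path_edges_append[of xs y "ys @ [x]"] Cons by simp
    also have "\<dots> = path_edges ((y # ys) @ x # xs' @ [y])"
      using path_edges_append[of "y # ys" x "xs' @ [y]"] Cons by auto
    finally show ?thesis using Cons by (simp add: cyclic_edges_def)
  qed (simp add: cyclic_edges_def)
qed

section \<open>Ear-free sets and the cactus condition on vertex lists\<close>

definition at_distance_le2 :: "('a \<Rightarrow> 'a \<Rightarrow> bool) \<Rightarrow> 'a \<Rightarrow> 'a \<Rightarrow> bool" where
  "at_distance_le2 adj x y \<longleftrightarrow> x \<noteq> y \<and> (adj x y \<or> (\<exists>z. adj x z \<and> adj z y))"

text \<open>A closed ear, with \<open>s = t\<close>, is permitted, so that a cycle may still be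
  attached at one vertex; so is an edge inside \<open>S\<close>, since \<open>q\<close> is
  nonempty.\<close>

definition ear_free :: "('a \<Rightarrow> 'a \<Rightarrow> bool) \<Rightarrow> 'a set \<Rightarrow> bool" where
  "ear_free adj S \<longleftrightarrow> (\<forall>s q t. s \<in> S \<and> t \<in> S \<and> q \<noteq> [] \<and> distinct q \<and> set q \<inter> S = {} \<and>
    successively adj (s # q @ [t]) \<longrightarrow> s = t)"

lemma ear_freeD:
  assumes "ear_free adj S" "successively adj (s # q @ [t])" "s \<in> S" "t \<in> S" "q \<noteq> []" "distinct q"
    "set q \<inter> S = {}"
  shows "s = t"
  using assms unfolding ear_free_def by blast

text \<open>The cactus property for a symmetric relation, so that paths and cycles can be handled as
  vertex lists; \<open>cactus_adj_dominates\<close> instantiates it with the adjacency of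
  \<open>G\<close>.\<close>

locale cactus_adj =
  fixes V :: "'a set" and adj :: "'a \<Rightarrow> 'a \<Rightarrow> bool"
  assumes finite_V: "finite V"
    and adj_in_V: "adj x y \<Longrightarrow> x \<in> V"
    and adj_sym: "adj x y \<Longrightarrow> adj y x"
    and adj_irrefl: "\<not> adj x x"
    and cyclic_edges_eq: "cyclic adj c \<Longrightarrow> cyclic adj d \<Longrightarrow> e \<in> cyclic_edges c \<Longrightarrow> e \<in> cyclic_edges d \<Longrightarrow>
      cyclic_edges c = cyclic_edges d"
begin

lemma successively_adj_rev: "successively adj (rev xs) \<longleftrightarrow> successively adj xs"
proof -
  have "(\<lambda>x y. adj y x) = adj" using adj_sym by blast
  then show ?thesis by (simp only: successively_rev)
qed

text \<open>The path and one of the two arcs of the cycle between its ends form a second cycle, which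
  shares the edges of that arc with the first.\<close>
lemma no_theta:
  assumes c: "cyclic adj c" and ab: "a \<in> set c" "b \<in> set c" "a \<noteq> b"
    and q: "distinct q" "set q \<inter> set c = {}" "successively adj (a # q @ [b])"
    and chord: "q = [] \<Longrightarrow> {a, b} \<notin> cyclic_edges c"
  shows False
proof -
  obtain cs ds where cd: "c = cs @ a # ds" using ab(1) by (meson split_list)
  obtain xs ys where xy: "ds @ cs = xs @ b # ys"
    using ab cd by (metis Un_iff in_set_conv_decomp set_append set_ConsD)
  \<comment> \<open>\<open>?c\<close> is \<open>c\<close> turned to start at \<open>a\<close>;
    \<open>?d\<close> keeps its arc from \<open>a\<close> to \<open>b\<close> and returns along the
    reversed \<open>q\<close>.\<close>
  let ?c = "a # xs @ b # ys"
  let ?d = "a # xs @ b # rev q"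
  have c': "cyclic adj ?c" "cyclic_edges ?c = cyclic_edges c"
    using cyclic_rotate[of adj cs a ds] c cd xy by auto
  have sc: "set ?c = set c" using cd xy by (metis Un_commute list.set(2) set_append Un_insert_right)
  have sq: "successively adj (b # rev q @ [a])"
    using q(3) successively_adj_rev[of "a # q @ [b]"] by simp
  have ce: "cyclic_edges ?c = path_edges (a # xs @ [b]) \<union> path_edges (b # ys @ [a])"
    unfolding cyclic_edges_def using path_edges_append[of "a # xs" b "ys @ [a]"] by simp
  have de: "cyclic_edges ?d = path_edges (a # xs @ [b]) \<union> path_edges (b # rev q @ [a])"
    unfolding cyclic_edges_def using path_edges_append[of "a # xs" b "rev q @ [a]"] by simp
  \<comment> \<open>With \<open>q\<close> empty, an empty \<open>xs\<close> would make
    \<open>a b\<close> an edge of \<open>c\<close>; hence \<open>?d\<close> always has at least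
    three vertices.\<close>
  have nonempty: "xs \<noteq> []" if "q = []"
    using chord[OF that] c'(2) ce by (cases xs) auto
  have "cyclic adj ?d"
    unfolding cyclic_def
  proof (intro conjI)
    have dc: "distinct ?c" using c'(1) by (simp add: cyclic_def)
    then show "distinct ?d" using q(1,2) sc by auto
    show "3 \<le> length ?d" using nonempty by (cases q; cases xs) auto
    have "successively adj (a # xs @ b # ys @ [a])" using c'(1) by (simp add: cyclic_def)
    then have "successively adj (a # xs @ [b])"
      by (simp add: successively_Cons successively_append_iff hd_append split: if_splits)
    then show "successively adj (?d @ [hd ?d])"
      using sq by (simp add: successively_Cons successively_append_iff hd_append split: if_splits)
  qed
  moreover obtain e where "e \<in> path_edges (a # xs @ [b])" by (cases xs) auto
  ultimately have eq: "cyclic_edges ?d = cyclic_edges c"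
    using cyclic_edges_eq[OF _ c'(1)] ce de c'(2) by blast
  \<comment> \<open>Equal edge sets are impossible: \<open>?d\<close> contains either the chord
    \<open>a b\<close> or an edge to \<open>last q\<close>, a vertex off \<open>c\<close>.\<close>
  show False
  proof (cases "q = []")
    case True
    then have "{b, a} \<in> cyclic_edges ?d" unfolding de by simp
    then show False using eq chord True by (simp add: insert_commute)
  next
    case False
    then have "{b, last q} \<in> cyclic_edges ?d"
      unfolding de by (simp add: path_edges_Cons hd_rev)
    then have "last q \<in> set (?c @ [hd ?c])"
      using eq c'(2) path_edges_subset unfolding cyclic_edges_def by blast
    then have "last q \<in> set c" unfolding sc[symmetric] by auto
    then show False using False q(2) by (meson disjoint_iff last_in_set)
  qed
qed

lemma ear_free_singleton: "ear_free adj {r}"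
  by (simp add: ear_free_def)

text \<open>A new ear must end at \<open>w\<close>. Prolonged by the edge \<open>u w\<close> it
  becomes an ear of \<open>S\<close> starting at \<open>u\<close> or, if its other end is
  \<open>u\<close>, a cycle through \<open>u w\<close>, which \<open>nc\<close> excludes.\<close>

lemma ear_free_insert:
  assumes S: "ear_free adj S" "u \<in> S" "w \<notin> S" "adj u w" and nc: "\<And>vs. \<not> cyclic adj (u # w # vs)"
  shows "ear_free adj (insert w S)"
proof -
  have *: False if st: "t \<in> S" and q: "q \<noteq> []" "distinct q" "set q \<inter> insert w S = {}"
    "successively adj (w # q @ [t])" for q t
  proof (cases "t = u")
    case True
    have "cyclic adj (u # w # q)"
      using q S True by (cases q) (auto simp: cyclic_def successively_Cons)
    then show False using nc by blast
  next
    case False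
    have "u = t"
      by (rule ear_freeD[OF S(1), of u "w # q" t]) (use q st S in \<open>auto simp: successively_Cons\<close>)
    then show False using False by simp
  qed
  show ?thesis
    unfolding ear_free_def
  proof (intro allI impI, elim conjE)
    fix s q t assume st: "s \<in> insert w S" "t \<in> insert w S" and q: "q \<noteq> []" "distinct q"
      "set q \<inter> insert w S = {}" "successively adj (s # q @ [t])"
    have r: "successively adj (t # rev q @ [s])"
      using q(4) successively_adj_rev[of "s # q @ [t]"] by simp
    consider "s = w" "t = w" | "s = w" "t \<in> S" | "s \<in> S" "t = w" | "s \<in> S" "t \<in> S" using st by blast
    then show "s = t"
    proof cases
      case 2
      then show ?thesis using *[of t q] q by simp
    next
      case 3
      then show ?thesis using *[of s "rev q"] q r by simp
    next
      case 4
      then show ?thesis using ear_freeD[OF S(1) q(4)] q by blast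
    qed simp
  qed
qed

text \<open>Following the cycle from \<open>u\<close>, the stretch up to the next vertex in
  \<open>S\<close> would be an ear; its interior is nonempty because the cycle leaves
  \<open>S\<close> right after \<open>u\<close>.\<close>

lemma ear_free_disjoint_cycle:
  assumes S: "ear_free adj S" "u \<in> S" and c: "cyclic adj (u # vs)" and hd: "hd vs \<notin> S"
  shows "set vs \<inter> S = {}"
proof (rule ccontr)
  assume "set vs \<inter> S \<noteq> {}"
  then obtain q s r where vs: "vs = q @ s # r" "s \<in> S" "\<forall>x\<in>set q. x \<notin> S"
    using split_list_first_prop[of vs "\<lambda>x. x \<in> S"] by blast
  have "q \<noteq> []" using vs hd by auto
  moreover have "successively adj (u # q @ [s])" "distinct q" "u \<noteq> s"
    using c \<open>q \<noteq> []\<close> by (auto simp: vs cyclic_def successively_Cons successively_append_iff)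
  ultimately show False using ear_freeD[OF S(1), of u q s] S(2) vs by auto
qed

text \<open>An ear with both ends on the cycle, \<open>u\<close> included, contradicts
  \<open>no_theta\<close>. An ear from another vertex of \<open>S\<close> to the cycle can be
  continued along the cycle to \<open>u\<close> and becomes an ear of \<open>S\<close>.\<close>

lemma ear_free_Un_cycle:
  assumes S: "ear_free adj S" "u \<in> S" and c: "cyclic adj (u # vs)" and disj: "set vs \<inter> S = {}"
  shows "ear_free adj (S \<union> set vs)"
proof -
  have *: False if st: "s \<in> S" "t \<in> set vs" and q: "q \<noteq> []" "distinct q" "set q \<inter> (S \<union> set vs) = {}"
    "successively adj (s # q @ [t])" for s q t
  proof (cases "s = u")
    case True
    have "s \<noteq> t" using st disj by auto
    moreover have "set q \<inter> set (u # vs) = {}" using q(3) S(2) by auto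
    ultimately show False
      using no_theta[OF c, of s t q] q st True by auto
  next
    case False
    obtain A B where vs: "vs = A @ t # B" using st(2) by (meson split_list)
    have B: "successively adj (t # B @ [u])"
      using c by (auto simp: vs cyclic_def successively_Cons successively_append_iff)
    have "s = u"
    proof (rule ear_freeD[OF S(1), of s "q @ t # B" u])
      show "successively adj (s # (q @ t # B) @ [u])"
        using q(1,4) B by (auto simp: successively_Cons successively_append_iff hd_append split: if_splits)
      show "distinct (q @ t # B)" using q c by (auto simp: vs cyclic_def)
      show "set (q @ t # B) \<inter> S = {}" using q disj vs by auto
    qed (use S st in auto)
    then show False using False by simp
  qed
  show ?thesis
    unfolding ear_free_def
  proof (intro allI impI, elim conjE)
    fix s q t assume st: "s \<in> S \<union> set vs" "t \<in> S \<union> set vs" and q: "q \<noteq> []" "distinct q"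
      "set q \<inter> (S \<union> set vs) = {}" "successively adj (s # q @ [t])"
    have r: "successively adj (t # rev q @ [s])"
      using q(4) successively_adj_rev[of "s # q @ [t]"] by simp
    consider "s \<in> S" "t \<in> S" | "s \<in> S" "t \<in> set vs" | "s \<in> set vs" "t \<in> S" | "s \<in> set vs" "t \<in> set vs"
      using st by blast
    then show "s = t"
    proof cases
      case 1
      show ?thesis by (rule ear_freeD[OF S(1) q(4)]) (use 1 q in auto)
    next
      case 2
      then show ?thesis using *[of s t q] q by blast
    next
      case 3
      then show ?thesis using *[of t s "rev q"] q r by auto
    next
      case 4
      have "set q \<inter> set (u # vs) = {}" using q(3) S(2) by auto
      then show ?thesis
        using no_theta[OF c, of s t q] q 4 by auto
    qed
  qed
qed

text \<open>A chord is the empty-path case of \<open>no_theta\<close>, so the adjacent pair is an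
  edge of the cycle; the second alternative is the closing edge.\<close>

lemma cycle_chordless:
  assumes c: "cyclic adj c" and ij: "i < j" "j < length c" "adj (c ! i) (c ! j)"
  shows "j = Suc i \<or> i = 0 \<and> j = length c - 1"
proof -
  have d: "distinct c" using c by (simp add: cyclic_def)
  have ne: "c ! i \<noteq> c ! j" using ij d by (simp add: nth_eq_iff_index_eq)
  have "{c ! i, c ! j} \<in> cyclic_edges c"
    by (rule ccontr) (use no_theta[OF c _ _ ne, of "[]"] ij in simp)
  then obtain k where k: "k < length c" "{c ! i, c ! j} = {(c @ [hd c]) ! k, (c @ [hd c]) ! Suc k}"
    unfolding cyclic_edges_def path_edges_nth by auto
  show ?thesis
  proof (cases "Suc k < length c")
    case True
    then have "{c ! i, c ! j} = {c ! k, c ! Suc k}" using k by (simp add: nth_append)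
    then show ?thesis
      using True k(1) ij d by (auto simp: doubleton_eq_iff nth_eq_iff_index_eq)
  next
    case False
    then have "k = length c - 1" "c \<noteq> []" using k by auto
    then have "{c ! i, c ! j} = {c ! k, c ! 0}" using k by (simp add: nth_append hd_conv_nth)
    then show ?thesis
      using k(1) ij d \<open>k = length c - 1\<close> \<open>c \<noteq> []\<close> by (auto simp: doubleton_eq_iff nth_eq_iff_index_eq)
  qed
qed

end

section \<open>Extending list colourings\<close>

context cactus_adj
begin

abbreviation near :: "'a \<Rightarrow> 'a \<Rightarrow> bool" where
  "near \<equiv> at_distance_le2 adj"

lemma near_sym: "near x y \<Longrightarrow> near y x"
  using adj_sym unfolding at_distance_le2_def by metis

text \<open>\<open>near\<close> is taken in the whole graph even though only \<open>S\<close> is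
  coloured, so extending the colouring creates no new conflicts inside \<open>S\<close>.\<close>

definition square_list_coloring :: "('a \<Rightarrow> 'c set) \<Rightarrow> 'a set \<Rightarrow> ('a \<Rightarrow> 'c) \<Rightarrow> bool" where
  "square_list_coloring L S f \<longleftrightarrow>
    (\<forall>v\<in>S. f v \<in> L v) \<and> (\<forall>x\<in>S. \<forall>y\<in>S. near x y \<longrightarrow> f x \<noteq> f y)"

lemma neighbours_finite: "finite {y. adj x y}"
  by (rule finite_subset[OF _ finite_V]) (use adj_in_V adj_sym in blast)

lemma extend_coloring_vertex:
  assumes S: "ear_free adj S" "S \<subseteq> V" "u \<in> S" "w \<notin> S" "adj u w"
    and nc: "\<And>vs. \<not> cyclic adj (u # w # vs)"
    and deg: "card {y. adj u y} \<le> 3" and L: "4 \<le> card (L w)"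
    and f: "square_list_coloring L S f"
  obtains f' where "square_list_coloring L (insert w S) f'"
proof -
  define N where "N = {s \<in> S. near w s}"
  have S': "ear_free adj (insert w S)" by (rule ear_free_insert[OF S(1,3-5) nc])
  \<comment> \<open>A second neighbour \<open>s\<close> of \<open>w\<close> in \<open>S\<close>
    would make \<open>u\<close>, \<open>w\<close>, \<open>s\<close> an ear.\<close>
  have nb: "s = u" if "adj w s" "s \<in> S" for s
    using ear_freeD[OF S(1), of u "[w]" s] S that by (simp add: successively_Cons)
  \<comment> \<open>The middle vertex of a path of length two from \<open>w\<close> to
    \<open>s\<close> lies in \<open>S\<close>, since \<open>insert w S\<close> is ear-free, and
    therefore equals \<open>u\<close>.\<close>
  have "N \<subseteq> insert u ({y. adj u y} - {w})"
  proof
    fix s assume "s \<in> N"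
    then have s: "s \<in> S" "s \<noteq> w" "near w s" using S by (auto simp: N_def)
    consider "adj w s" | z where "adj w z" "adj z s"
      using s by (auto simp: at_distance_le2_def)
    then show "s \<in> insert u ({y. adj u y} - {w})"
    proof cases
      case 2
      have "z \<noteq> w" using 2 adj_irrefl by blast
      have "z \<in> S"
      proof (rule ccontr)
        assume "z \<notin> S"
        then have "w = s"
          using ear_freeD[OF S', of w "[z]" s] 2 s \<open>z \<noteq> w\<close> by (simp add: successively_Cons)
        then show False using s by simp
      qed
      then show ?thesis using nb 2 s by auto
    qed (use nb s in auto)
  qed
  then have "card N \<le> card (insert u ({y. adj u y} - {w}))"
    using neighbours_finite by (intro card_mono) auto
  also have "\<dots> \<le> Suc (card ({y. adj u y} - {w}))" by (rule card_insert_le_m1) auto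
  also have "\<dots> \<le> 3" using deg S(5) neighbours_finite[of u] by simp
  finally have "card N \<le> 3" .
  moreover have "finite N" using S(2) finite_V by (auto simp: N_def intro: finite_subset)
  ultimately have "card (f ` N) < card (L w)" using L card_image_le[of N f] by linarith
  then have "\<not> L w \<subseteq> f ` N" using card_mono[of "f ` N" "L w"] \<open>finite N\<close> by auto
  then obtain x where x: "x \<in> L w" "x \<notin> f ` N" by blast
  have new: "x \<noteq> f s" if "s \<in> S" "near w s" for s using that x(2) by (auto simp: N_def)
  have "square_list_coloring L (insert w S) (f(w := x))"
    unfolding square_list_coloring_def
  proof (intro conjI ballI impI)
    fix v assume "v \<in> insert w S"
    then show "(f(w := x)) v \<in> L v" using f x(1) by (auto simp: square_list_coloring_def)
  next
    fix y z assume yz: "y \<in> insert w S" "z \<in> insert w S" "near y z"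
    then have "y \<noteq> z" by (simp add: at_distance_le2_def)
    then consider "y = w" "z \<in> S" "z \<noteq> w" | "z = w" "y \<in> S" "y \<noteq> w" | "y \<in> S" "y \<noteq> w" "z \<in> S" "z \<noteq> w"
      using yz by blast
    then show "(f(w := x)) y \<noteq> (f(w := x)) z"
    proof cases
      case 1
      then show ?thesis using new[of z] yz(3) by simp
    next
      case 2
      then show ?thesis using new[of y] near_sym[OF yz(3)] by auto
    next
      case 3
      then show ?thesis using f yz(3) by (simp add: square_list_coloring_def)
    qed
  qed
  then show thesis by (rule that)
qed

lemma extend_coloring_cycle:
  assumes S: "ear_free adj S" "S \<subseteq> V" "u \<in> S" and c: "cyclic adj (u # vs)" and disj: "set vs \<inter> S = {}"
    and K: "4 \<le> K" "length vs = 4 \<Longrightarrow> 5 \<le> K"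
    and deg: "card {y. adj u y} \<le> 3" and L: "\<And>v. v \<in> set vs \<Longrightarrow> finite (L v) \<and> K \<le> card (L v)"
    and f: "square_list_coloring L S f"
  obtains f' where "square_list_coloring L (S \<union> set vs) f'"
proof -
  let ?m = "length vs"
  have S': "ear_free adj (S \<union> set vs)" by (rule ear_free_Un_cycle[OF S(1,3) c disj])
  have m: "2 \<le> ?m" and dist: "distinct vs"
    using c by (simp_all add: cyclic_def)
  then have nonempty: "vs \<noteq> []" by auto
  have closed_path: "successively adj ((u # vs) @ [u])" using c by (simp add: cyclic_def)
  then have path: "successively adj (u # vs)" and "adj (last vs) u"
    using nonempty unfolding successively_append_iff by simp_all
  moreover have "adj u (hd vs)" using path nonempty by (simp add: successively_Cons)
  ultimately have ends: "adj u (vs ! 0)" "adj u (vs ! (?m - 1))"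
    using nonempty adj_sym by (simp_all add: hd_conv_nth last_conv_nth)
  \<comment> \<open>\<open>vs ! i\<close> has index \<open>Suc i\<close> in \<open>u # vs\<close>,
    so the closing edge of \<open>cycle_chordless\<close>, which contains \<open>u\<close>, cannot
    occur.\<close>
  have chord: "j = Suc i \<or> i = Suc j" if "adj (vs ! i) (vs ! j)" "i < ?m" "j < ?m" for i j
  proof -
    have "i \<noteq> j" using that adj_irrefl by auto
    then show ?thesis
      using cycle_chordless[OF c, of "Suc i" "Suc j"] cycle_chordless[OF c, of "Suc j" "Suc i"] that adj_sym
      by (cases "i < j") auto
  qed
  \<comment> \<open>The cycle from \<open>u\<close> to \<open>vs ! i\<close>, followed by
    \<open>s\<close>, has its interior outside \<open>S\<close>, so it can only return to
    \<open>u\<close>; chordlessness then puts \<open>vs ! i\<close> next to \<open>u\<close> on the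
    cycle.\<close>
  have nb: "s = u \<and> (i = 0 \<or> i = ?m - 1)" if i: "i < ?m" "adj (vs ! i) s" "s \<in> S" for i s
  proof -
    have "s = u"
    proof (rule ear_freeD[OF S(1), symmetric])
      have "successively adj (u # take (Suc i) vs)"
        using path append_take_drop_id[of "Suc i" vs] successively_append_iff[of adj "u # take (Suc i) vs" "drop (Suc i) vs"]
        by simp
      moreover have "last (take (Suc i) vs) = vs ! i" using i by (simp add: take_Suc_conv_app_nth)
      ultimately show "successively adj (u # take (Suc i) vs @ [s])"
        using i successively_append_iff[of adj "u # take (Suc i) vs" "[s]"] by auto
      show "set (take (Suc i) vs) \<inter> S = {}" using disj set_take_subset[of "Suc i" vs] by auto
    qed (use i dist S m in auto)
    moreover have "Suc i = 1 \<or> Suc i = ?m"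
      using cycle_chordless[OF c, of 0 "Suc i"] i adj_sym \<open>s = u\<close> by auto
    ultimately show ?thesis by auto
  qed
  \<comment> \<open>A common neighbour outside would be the interior of an ear of the enlarged
    set.\<close>
  have closed: "z \<in> S \<union> set vs" if "x \<in> S \<union> set vs" "y \<in> S \<union> set vs" "x \<noteq> y" "adj x z" "adj z y" for x y z
    using ear_freeD[OF S', of x "[z]" y] that by (auto simp: successively_Cons)
  \<comment> \<open>A middle vertex in \<open>S\<close> must be \<open>u\<close>, which joins only
    positions \<open>0\<close> and \<open>?m - 1\<close>; a middle vertex on the cycle joins
    positions at most two apart.\<close>
  have near_cycle: "j \<le> i + 2 \<or> i = 0 \<and> j = ?m - 1" if ij: "i < j" "j < ?m" "near (vs ! i) (vs ! j)" for i j
  proof -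
    consider "adj (vs ! i) (vs ! j)" | z where "adj (vs ! i) z" "adj z (vs ! j)" "vs ! i \<noteq> vs ! j"
      using ij(3) by (auto simp: at_distance_le2_def)
    then show ?thesis
    proof cases
      case 1
      then show ?thesis using chord[of i j] ij by auto
    next
      case 2
      then consider "z \<in> S" | "z \<in> set vs" using closed[of "vs ! i" "vs ! j" z] ij by auto
      then show ?thesis
      proof cases
        case 1
        then show ?thesis using nb[of i z] nb[of j z] 2 adj_sym ij by auto
      next
        case z: 2
        then obtain k where "k < ?m" "z = vs ! k" by (auto simp: in_set_conv_nth)
        then show ?thesis using chord[of i k] chord[of k j] 2 ij by auto
      qed
    qed
  qed
  define N where "N i = {s \<in> S. near (vs ! i) s}" for i
  \<comment> \<open>A path of length at most two from \<open>vs\<close> into \<open>S\<close> enters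
    \<open>S\<close> at \<open>u\<close>. It stops there, having started at an end of
    \<open>vs\<close> or one step further in, or it goes on from \<open>u\<close> to another
    neighbour of \<open>u\<close>.\<close>
  have N: "s = u \<and> (i = 0 \<or> i = ?m - 1 \<or> i = 1 \<or> i = ?m - 2) \<or> adj u s \<and> (i = 0 \<or> i = ?m - 1)"
    if i: "i < ?m" "s \<in> N i" for i s
  proof -
    have s: "s \<in> S" "near (vs ! i) s" using i by (auto simp: N_def)
    consider "adj (vs ! i) s" | z where "adj (vs ! i) z" "adj z s" "vs ! i \<noteq> s"
      using s by (auto simp: at_distance_le2_def)
    then show ?thesis
    proof cases
      case 1
      then show ?thesis using nb[of i s] i s by auto
    next
      case 2
      then consider "z \<in> S" | "z \<in> set vs" using closed[of "vs ! i" s z] i s by auto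
      then show ?thesis
      proof cases
        case 1
        then show ?thesis using nb[of i z] 2 i by auto
      next
        case z: 2
        then obtain k where k: "k < ?m" "z = vs ! k" by (auto simp: in_set_conv_nth)
        then have "s = u" "k = 0 \<or> k = ?m - 1" using nb[of k s] 2 s by auto
        then show ?thesis using chord[of i k] 2 i k by auto
      qed
    qed
  qed
  have finN: "finite (N i)" for i using S(2) finite_V by (auto simp: N_def intro: finite_subset)
  have card_N: "card (N i) \<le> (if i = 0 \<or> i = ?m - 1 then 2 else if i = 1 \<or> i = ?m - 2 then 1 else 0)"
    if i: "i < ?m" for i
  proof -
    consider "i = 0 \<or> i = ?m - 1" | "i \<noteq> 0" "i \<noteq> ?m - 1" "i = 1 \<or> i = ?m - 2"
      | "i \<noteq> 0" "i \<noteq> ?m - 1" "i \<noteq> 1" "i \<noteq> ?m - 2" by blast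
    then show ?thesis
    proof cases
      case 1
      \<comment> \<open>The two cycle neighbours of \<open>u\<close> are not in \<open>S\<close>, so
        at most one neighbour of \<open>u\<close> remains; with \<open>u\<close> itself this makes
        two blocking vertices.\<close>
      let ?A = "{vs ! 0, vs ! (?m - 1)}"
      have "vs ! 0 = vs ! (?m - 1) \<longleftrightarrow> 0 = ?m - 1"
        using m by (intro nth_eq_iff_index_eq[OF dist]) auto
      then have "vs ! 0 \<noteq> vs ! (?m - 1)" using m by linarith
      then have A: "card ?A = 2" by (rule card_2_iff[THEN iffD2, OF exI, OF exI, OF conjI[OF refl]])
      have dA: "card ({y. adj u y} - ?A) = card {y. adj u y} - card ?A"
        using ends by (intro card_Diff_subset) auto
      have "?A \<subseteq> set vs"
        using nonempty by (auto intro!: nth_mem)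
      then have A_disj: "?A \<inter> S = {}" using disj by blast
      have "N i \<subseteq> insert u ({y. adj u y} - ?A)"
      proof
        fix s assume s: "s \<in> N i"
        then have "s \<in> S" by (simp add: N_def)
        then have "s \<notin> ?A" using A_disj by blast
        then show "s \<in> insert u ({y. adj u y} - ?A)" using N[OF i s] by blast
      qed
      then have "card (N i) \<le> card (insert u ({y. adj u y} - ?A))"
        using neighbours_finite by (intro card_mono) auto
      also have "\<dots> \<le> Suc (card ({y. adj u y} - ?A))" by (rule card_insert_le_m1) auto
      also have "\<dots> \<le> 2" using dA A deg by linarith
      finally show ?thesis by (simp only: if_P[OF 1])
    next
      case 2
      have "s = u" if s: "s \<in> N i" for s
        using N[OF i s] by (simp only: 2 simp_thms)
      then have "N i \<subseteq> {u}" by blast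
      then have "card (N i) \<le> 1" using card_mono[of "{u}" "N i"] by simp
      then show ?thesis by (simp only: 2 simp_thms if_True if_False)
    next
      case 3
      have "s \<notin> N i" for s
      proof
        assume "s \<in> N i"
        from N[OF i this] show False by (simp only: 3 simp_thms)
      qed
      then have "N i = {}" by blast
      then show ?thesis by simp
    qed
  qed
  define F where "F i = L (vs ! i) - f ` N i" for i
  \<comment> \<open>The losses 2, 1 and 0 leave the list sizes that
    \<open>cycle_rest_coloring\<close> expects.\<close>
  have F: "(if i = 0 \<or> i = ?m - 1 then K - 2 else if i = 1 \<or> i = ?m - 2 then K - 1 else K) \<le> card (F i)"
    if i: "i < ?m" for i
  proof -
    have "K \<le> card (L (vs ! i))" using L i by simp
    moreover have "card (L (vs ! i)) - card (f ` N i) \<le> card (F i)"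
      unfolding F_def using finN by (intro diff_card_le_card_Diff) auto
    moreover have "card (f ` N i) \<le> card (N i)" using finN by (rule card_image_le)
    ultimately have le: "K - card (N i) \<le> card (F i)" by linarith
    have eq: "(if P then K - 2 else if Q then K - 1 else K) = K - (if P then 2 else if Q then 1 else 0)"
      for P Q by simp
    show ?thesis unfolding eq by (rule order_trans[OF diff_le_mono2[OF card_N[OF i]] le])
  qed
  obtain g where g: "\<And>i. i < ?m \<Longrightarrow> g i \<in> F i"
    "\<And>i j. i < j \<Longrightarrow> j < ?m \<Longrightarrow> j \<le> i + 2 \<or> i = 0 \<and> j = ?m - 1 \<Longrightarrow> g i \<noteq> g j"
    using cycle_rest_coloring[OF K(1) m K(2) F] by blast
  define f' where "f' x = (if x \<in> set vs then g (inv_into {..<?m} ((!) vs) x) else f x)" for x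
  have "inj_on ((!) vs) {..<?m}" using dist by (auto intro: inj_on_nth)
  then have f'_vs: "f' (vs ! i) = g i" if "i < ?m" for i
    using that by (simp add: f'_def inv_into_f_f)
  have f'_S: "f' x = f x" if "x \<in> S" for x using that disj by (auto simp: f'_def)
  have mixed: "f' x \<noteq> f' y" if xy: "x \<in> S" "y \<in> set vs" "near x y" for x y
  proof -
    obtain i where i: "i < ?m" "y = vs ! i" using xy by (auto simp: in_set_conv_nth)
    have "near (vs ! i) x" using near_sym[OF xy(3)] i(2) by simp
    then have "f x \<in> f ` N i" using xy(1) by (simp add: N_def)
    moreover have "g i \<notin> f ` N i" using g(1)[OF i(1)] by (simp add: F_def)
    ultimately have "f x \<noteq> g i" by metis
    then show ?thesis using f'_vs[OF i(1)] f'_S[OF xy(1)] i(2) by simp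
  qed
  have "square_list_coloring L (S \<union> set vs) f'"
    unfolding square_list_coloring_def
  proof (intro conjI ballI impI)
    fix v assume "v \<in> S \<union> set vs"
    then show "f' v \<in> L v"
    proof
      assume "v \<in> S"
      then show ?thesis using f f'_S by (auto simp: square_list_coloring_def)
    next
      assume "v \<in> set vs"
      then obtain i where "i < ?m" "v = vs ! i" by (auto simp: in_set_conv_nth)
      then show ?thesis using g(1) f'_vs by (auto simp: F_def)
    qed
  next
    fix x y assume xy: "x \<in> S \<union> set vs" "y \<in> S \<union> set vs" "near x y"
    consider "x \<in> S" "y \<in> S" | "x \<in> S" "y \<in> set vs" | "x \<in> set vs" "y \<in> S" | "x \<in> set vs" "y \<in> set vs"
      using xy by blast
    then show "f' x \<noteq> f' y"
    proof cases
      case 1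
      then show ?thesis using f f'_S xy by (auto simp: square_list_coloring_def)
    next
      case 2
      then show ?thesis using mixed xy by blast
    next
      case 3
      then show ?thesis using mixed[of y x] near_sym[OF xy(3)] by auto
    next
      case 4
      then obtain i j where ij: "i < ?m" "x = vs ! i" "j < ?m" "y = vs ! j" by (auto simp: in_set_conv_nth)
      have "i \<noteq> j" using ij xy by (auto simp: at_distance_le2_def)
      then consider "i < j" | "j < i" by linarith
      then show ?thesis
      proof cases
        case 1
        then show ?thesis using g(2)[OF 1 ij(3)] near_cycle[OF 1 ij(3)] f'_vs ij xy by auto
      next
        case 2
        then show ?thesis using g(2)[OF 2 ij(1)] near_cycle[OF 2 ij(1)] f'_vs ij near_sym[OF xy(3)] by auto
      qed
    qed
  qed
  then show thesis by (rule that)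
qed

text \<open>The bound on \<open>K\<close> rises from 4 to 5 when a 5-cycle exists, so that one
  argument serves both parts of the theorem.\<close>

lemma square_list_colorable:
  assumes conn: "\<And>x y. x \<in> V \<Longrightarrow> y \<in> V \<Longrightarrow> adj\<^sup>*\<^sup>* x y"
    and K: "4 \<le> K" "\<And>c. cyclic adj c \<Longrightarrow> length c = 5 \<Longrightarrow> 5 \<le> K"
    and deg: "\<And>x. card {y. adj x y} \<le> 3" and L: "\<And>v. v \<in> V \<Longrightarrow> finite (L v) \<and> K \<le> card (L v)"
  shows "\<exists>f. square_list_coloring L V f"
proof (cases "V = {}")
  case True
  then show ?thesis by (simp add: square_list_coloring_def)
next
  case False
  \<comment> \<open>Induction on the number of vertices outside \<open>S\<close>, with ear-freeness
    of \<open>S\<close> as invariant.\<close>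
  have grow: "\<exists>f. square_list_coloring L V f"
    if "S \<subseteq> V" "S \<noteq> {}" "ear_free adj S" "square_list_coloring L S f" for S f
    using that
  proof (induction "card (V - S)" arbitrary: S f rule: less_induct)
    case less
    show ?case
    proof (cases "S = V")
      case True
      then show ?thesis using less by blast
    next
      case False
      then obtain x y where xy: "x \<in> S" "y \<in> V" "y \<notin> S" using less by blast
      have "adj\<^sup>*\<^sup>* x y" using conn xy less by blast
      then have "\<exists>u w. u \<in> S \<and> w \<notin> S \<and> adj u w" using xy(1,3)
        by (induction rule: converse_rtranclp_induct) auto
      then obtain u w where uw: "u \<in> S" "w \<notin> S" "adj u w" by blast
      have smaller: "card (V - T) < card (V - S)" if "S \<subseteq> T" "w \<in> T" for T
        using that uw adj_in_V[OF adj_sym[OF uw(3)]] finite_V by (intro psubset_card_mono) auto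
      show ?thesis
      proof (cases "\<exists>vs. cyclic adj (u # w # vs)")
        case True
        then obtain vs where c: "cyclic adj (u # w # vs)" by blast
        have disj: "set (w # vs) \<inter> S = {}"
          using ear_free_disjoint_cycle[OF less(4) uw(1) c] uw by simp
        have "successively adj ((w # vs) @ [u])" using c by (simp add: cyclic_def successively_Cons)
        then have "x \<in> V" if x: "x \<in> set (w # vs)" for x
        proof -
          obtain as bs where "w # vs = as @ x # bs" using split_list[OF x] by blast
          then have "adj x (hd (bs @ [u]))" using \<open>successively adj ((w # vs) @ [u])\<close>
            by (auto simp: successively_append_iff successively_Cons)
          then show ?thesis by (rule adj_in_V)
        qed
        then have sub: "set (w # vs) \<subseteq> V" by blast
        obtain f' where f': "square_list_coloring L (S \<union> set (w # vs)) f'"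
        proof (rule extend_coloring_cycle[OF less(4,2) uw(1) c disj K(1) _ deg _ less(5)])
          \<comment> \<open>Together with \<open>u\<close> the cycle then has five vertices.\<close>
          assume "length (w # vs) = 4"
          then show "5 \<le> K" using K(2)[OF c] by simp
        qed (use L sub in auto)
        show ?thesis
        proof (rule less(1)[OF _ _ _ _ f'])
          show "ear_free adj (S \<union> set (w # vs))" by (rule ear_free_Un_cycle[OF less(4) uw(1) c disj])
          show "card (V - (S \<union> set (w # vs))) < card (V - S)" by (rule smaller) auto
          show "S \<union> set (w # vs) \<subseteq> V" "S \<union> set (w # vs) \<noteq> {}" using less(2) sub by auto
        qed
      next
        case False
        then have nc: "\<not> cyclic adj (u # w # vs)" for vs by blast
        have w: "w \<in> V" using adj_in_V[OF adj_sym[OF uw(3)]] .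
        have "4 \<le> card (L w)" using L[OF w] K(1) by linarith
        then obtain f' where f': "square_list_coloring L (insert w S) f'"
          using extend_coloring_vertex[OF less(4,2) uw nc deg _ less(5)] by blast
        show ?thesis
        proof (rule less(1)[OF _ _ _ ear_free_insert[OF less(4) uw nc] f'])
          show "card (V - insert w S) < card (V - S)" by (rule smaller) auto
          show "insert w S \<subseteq> V" "insert w S \<noteq> {}" using less(2) w by auto
        qed
      qed
    qed
  qed
  obtain r where r: "r \<in> V" using False by blast
  have "L r \<noteq> {}" using L[OF r] K(1) by auto
  then obtain x where "x \<in> L r" by blast
  then have "square_list_coloring L {r} (\<lambda>_. x)"
    by (auto simp: square_list_coloring_def at_distance_le2_def)
  then show ?thesis using grow[of "{r}"] ear_free_singleton r by blast
qed

end

section \<open>Blocks, distances and colourings of digraphs\<close>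

text \<open>Chordlessness in the index form of \<open>cycle_graph\<close>: the closing edge is the
  case where \<open>Suc\<close> reaches \<open>length c\<close> and the remainder is 0.\<close>

lemma (in cactus_adj) cyclic_adj_iff:
  assumes c: "cyclic adj c" and ij: "i < length c" "j < length c"
  shows "adj (c ! i) (c ! j) \<longleftrightarrow> j = Suc i mod length c \<or> i = Suc j mod length c"
proof -
  have n: "3 \<le> length c" using c by (simp add: cyclic_def)
  have step: "adj (c ! i) (c ! (Suc i mod length c))" if i: "i < length c" for i
  proof -
    have "adj ((c @ [hd c]) ! i) ((c @ [hd c]) ! Suc i)"
      using c i successively_nth[of adj "c @ [hd c]" i] by (simp add: cyclic_def)
    moreover have "(c @ [hd c]) ! Suc i = c ! (Suc i mod length c)"
    proof (cases "Suc i < length c")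
      case False
      then have "Suc i = length c" using i by simp
      then show ?thesis using n by (simp add: nth_append hd_conv_nth flip: length_greater_0_conv)
    qed (simp add: nth_append)
    ultimately show ?thesis using i by (simp add: nth_append)
  qed
  have conv: "j = Suc i mod length c \<or> i = Suc j mod length c"
    if ij: "i < j" "j < length c" "adj (c ! i) (c ! j)" for i j
  proof -
    consider "j = Suc i" | "i = 0" "j = length c - 1" using cycle_chordless[OF c ij] by blast
    then show ?thesis
    proof cases
      case 1
      then show ?thesis using ij(2) by simp
    next
      case 2
      then have "Suc j = length c" using ij(2) by simp
      then show ?thesis using 2(1) by simp
    qed
  qed
  show ?thesis
  proof
    assume a: "adj (c ! i) (c ! j)"
    then have "i \<noteq> j" using adj_irrefl by auto
    then show "j = Suc i mod length c \<or> i = Suc j mod length c"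
      using conv[of i j] conv[of j i] a adj_sym[OF a] ij by (cases "i < j") auto
  next
    assume "j = Suc i mod length c \<or> i = Suc j mod length c"
    then show "adj (c ! i) (c ! j)" using step[OF ij(1)] step[OF ij(2)] adj_sym by auto
  qed
qed

text \<open>The walk is cut at its first entrance into \<open>S\<close>; whenever the new first
  vertex already occurs on the path, the part before that occurrence is dropped.
  \<open>block_cycle\<close> uses this to return to a cycle.\<close>

lemma first_entrance_path:
  assumes "P\<^sup>*\<^sup>* x y" "x \<notin> S" "y \<in> S"
  shows "\<exists>q t. t \<in> S \<and> q \<noteq> [] \<and> hd q = x \<and> distinct q \<and> set q \<inter> S = {} \<and> successively P (q @ [t])"
  using assms
proof (induction rule: converse_rtranclp_induct)
  case (step x z)
  show ?case
  proof (cases "z \<in> S")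
    case True
    then show ?thesis using step by (intro exI[of _ "[x]"] exI[of _ z]) (auto simp: successively_Cons)
  next
    case False
    then obtain q t where q: "t \<in> S" "q \<noteq> []" "hd q = z" "distinct q" "set q \<inter> S = {}"
      "successively P (q @ [t])"
      using step by blast
    show ?thesis
    proof (cases "x \<in> set q")
      case True
      then obtain as bs where "q = as @ x # bs" by (meson split_list)
      then show ?thesis
        using q by (intro exI[of _ "x # bs"] exI[of _ t]) (auto simp: successively_append_iff)
    next
      case False
      then show ?thesis
        using q step by (intro exI[of _ "x # q"] exI[of _ t]) (auto simp: successively_Cons)
    qed
  qed
qed simp

lemma successively_rtranclp_hd:
  assumes "successively P w" "x \<in> set w"
  shows "P\<^sup>*\<^sup>* (hd w) x"
  using assms by (induction P w rule: successively.induct) (auto intro: converse_rtranclp_into_rtranclp)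

section \<open>From vertex lists to arc walks and arc cycles\<close>

lemma (in wf_digraph) awalk_of_vertices:
  assumes "w \<noteq> []" "hd w \<in> verts G" "successively (dominates G) w"
  shows "\<exists>p. awalk (hd w) p (last w) \<and> awalk_verts (hd w) p = w \<and> edge_of G ` set p = path_edges w"
  using assms
proof (induction w rule: path_edges.induct)
  case (1 x y zs)
  then have xy: "x \<rightarrow> y" by simp
  then obtain e where e: "e \<in> arcs G" "tail G e = x" "head G e = y" by auto
  obtain p where "awalk y p (last (y # zs))" "awalk_verts y p = y # zs"
    "edge_of G ` set p = path_edges (y # zs)"
    using 1 adj_in_verts[OF xy] by auto
  then show ?case
    using e by (intro exI[of _ "e # p"]) (auto simp: awalk_Cons_iff edge_of_def)
next
  case ("2_2" v)
  then show ?case by (intro exI[of _ "[]"]) (simp add: awalk_Nil_iff)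
qed simp

text \<open>Transfers list cycles to arc cycles, in terms of which the cactus condition is
  stated.\<close>

lemma (in wf_digraph) cyclic_arc_cycle:
  assumes c: "cyclic (dominates G) c"
  shows "\<exists>p. cycle p \<and> length p = length c \<and> edge_of G ` set p = cyclic_edges c"
proof -
  have ne: "c \<noteq> []" using c by (auto simp: cyclic_def)
  have s: "successively (dominates G) (c @ [hd c])" using c by (simp add: cyclic_def)
  have "hd c \<in> verts G" using s ne by (cases c; cases "tl c") (auto dest: adj_in_verts)
  then obtain p where p: "awalk (hd c) p (hd c)" "awalk_verts (hd c) p = c @ [hd c]"
    "edge_of G ` set p = cyclic_edges c"
    using awalk_of_vertices[of "c @ [hd c]"] s ne by (auto simp: cyclic_edges_def)
  have len: "length p = length c" using length_awalk_verts[of "hd c" p] p(2) by simp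
  have "distinct (tl c @ [hd c])" using c ne by (cases c) (auto simp: cyclic_def)
  then have "cycle p" unfolding cycle_def using p len ne by (intro exI[of _ "hd c"]) auto
  then show ?thesis using len p by blast
qed

lemma (in wf_digraph) cycle_edges_cyclic:
  assumes c: "cyclic (dominates G) c"
  shows "cycle_edges G (cyclic_edges c)"
proof -
  obtain p where p: "cycle p" "length p = length c" "edge_of G ` set p = cyclic_edges c"
    using cyclic_arc_cycle[OF c] by blast
  then show ?thesis using c unfolding cycle_edges_def by (intro exI[of _ p]) (simp add: cyclic_def)
qed

lemma (in graph) cactus_adj_dominates:
  assumes "cactus G"
  shows "cactus_adj (verts G) (dominates G)"
proof
  show "finite (verts G)" by simp
  show "x \<in> verts G" if "x \<rightarrow> y" for x y using adj_in_verts[OF that] by blast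
  show "y \<rightarrow> x" if "x \<rightarrow> y" for x y using that by (rule graph_symmetric)
  show "\<not> x \<rightarrow> x" for x using adj_not_same by blast
  fix c d e assume c: "cyclic (dominates G) c" "cyclic (dominates G) d"
    and e: "e \<in> cyclic_edges c" "e \<in> cyclic_edges d"
  obtain p where p: "cycle p" "edge_of G ` set p = cyclic_edges c"
    using cyclic_arc_cycle[OF c(1)] by blast
  \<comment> \<open>The cactus condition ranges over arcs, so the shared edge is traced back to an
    arc of the walk along \<open>c\<close>.\<close>
  have "e \<in> edge_of G ` set p" using e(1) p(2) by simp
  then obtain a where a: "a \<in> set p" "e = edge_of G a" by (rule imageE)
  have "set p \<subseteq> arcs G" using p(1) by (auto simp: cycle_def)
  then have "a \<in> arcs G" using a(1) by blast
  then show "cyclic_edges c = cyclic_edges d"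
    using assms cycle_edges_cyclic[OF c(1)] cycle_edges_cyclic[OF c(2)] e
    unfolding cactus_def a(2) by blast
qed

section \<open>The cycles of a cactus are blocks\<close>

lemma (in sym_digraph) connected_iff_rtranclp:
  "Digraph_Component.connected G \<longleftrightarrow>
    verts G \<noteq> {} \<and> (\<forall>u\<in>verts G. \<forall>v\<in>verts G. (dominates G)\<^sup>*\<^sup>* u v)"
  by (auto simp: connected_def strongly_connected_def reachable_mk_symmetric_eq[OF sym_arcs]
      reachable_conv rtranclp_rtrancl_eq)

lemma (in graph) graph_induce_subgraph:
  assumes "S \<subseteq> verts G"
  shows "graph (G \<restriction> S)"
proof -
  have i: "induced_subgraph (G \<restriction> S) G" using assms by blast
  interpret H: digraph "G \<restriction> S" using i by (rule digraphI_induced)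
  show ?thesis using H.graphI induced_graph_imp_symmetric[OF sym_arcs i] by blast
qed

lemma dominates_induce_subgraph_iff:
  "u \<rightarrow>\<^bsub>G \<restriction> S\<^esub> v \<longleftrightarrow> u \<rightarrow>\<^bsub>G\<^esub> v \<and> u \<in> S \<and> v \<in> S"
  by (auto simp: arcs_ends_conv)

lemma del_vert_induce_subgraph:
  "pre_digraph.del_vert (G \<restriction> S) v = G \<restriction> (S - {v})"
  by (auto simp: pre_digraph.del_vert_def induce_subgraph_def)

lemma (in graph) connected_induce_path:
  assumes "w \<noteq> []" "set w \<subseteq> verts G" "successively (dominates G) w"
  shows "Digraph_Component.connected (G \<restriction> set w)"
proof -
  interpret H: graph "G \<restriction> set w" using assms(2) by (rule graph_induce_subgraph)
  have s: "successively (dominates (G \<restriction> set w)) w"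
    using assms(3) by (rule successively_mono) (auto simp: dominates_induce_subgraph_iff)
  have "symp (dominates (G \<restriction> set w))" using H.graph_symmetric by (auto intro: sympI)
  then have "symp (dominates (G \<restriction> set w))\<^sup>*\<^sup>*" by (rule symp_rtranclp)
  then have "(dominates (G \<restriction> set w))\<^sup>*\<^sup>* u v" if "u \<in> set w" "v \<in> set w" for u v
    using successively_rtranclp_hd[OF s] that by (meson rtranclp_trans sympD)
  then show ?thesis using assms(1) by (simp add: H.connected_iff_rtranclp)
qed

lemma (in graph) cyclic_in_verts:
  assumes c: "cyclic (dominates G) c"
  shows "set c \<subseteq> verts G"
proof
  fix x assume "x \<in> set c"
  then obtain as bs where "c = as @ x # bs" by (meson split_list)
  then have "x \<rightarrow> hd (bs @ [hd c])"
    using c by (auto simp: cyclic_def successively_append_iff successively_Cons)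
  then show "x \<in> verts G" by (rule adj_in_verts)
qed

text \<open>Once the cycle is turned to start at the deleted vertex, the rest is visibly a path,
  hence connected.\<close>

lemma (in graph) two_connected_induce_cycle:
  assumes c: "cyclic (dominates G) c"
  shows "two_connected (G \<restriction> set c)"
  unfolding two_connected_def
proof (intro conjI ballI)
  have s: "successively (dominates G) c" using c by (auto simp: cyclic_def successively_append_iff)
  have "c \<noteq> []" using c by (auto simp: cyclic_def)
  then show "Digraph_Component.connected (G \<restriction> set c)"
    using connected_induce_path cyclic_in_verts[OF c] s by blast
  show "graph (G \<restriction> set c)" using cyclic_in_verts[OF c] by (rule graph_induce_subgraph)
  show "3 \<le> card (verts (G \<restriction> set c))" using c by (simp add: cyclic_def distinct_card)
  fix v assume "v \<in> verts (G \<restriction> set c)"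
  then obtain xs ys where xy: "c = xs @ v # ys" using split_list by fastforce
  then have r: "cyclic (dominates G) (v # ys @ xs)" using cyclic_rotate(1) c by metis
  have ne: "ys @ xs \<noteq> []" using r by (auto simp: cyclic_def)
  have succ: "successively (dominates G) (ys @ xs)"
    using r by (cases xs) (auto simp: cyclic_def successively_Cons successively_append_iff)
  have set: "set (ys @ xs) = set c - {v}" using c xy by (auto simp: cyclic_def)
  have "Digraph_Component.connected (G \<restriction> set (ys @ xs))"
    using cyclic_in_verts[OF c] set by (intro connected_induce_path[OF ne _ succ]) blast
  then show "Digraph_Component.connected (pre_digraph.del_vert (G \<restriction> set c) v)"
    by (simp only: set del_vert_induce_subgraph)
qed

lemma (in graph) graph_del_vert: "graph (del_vert v)"
proof -
  have "del_vert v = G \<restriction> (verts G - {v})"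
    by (auto simp: del_vert_def induce_subgraph_def)
  then show ?thesis using graph_induce_subgraph[of "verts G - {v}"] by auto
qed

text \<open>A larger two-connected \<open>H\<close> has an edge \<open>u w\<close> leaving the
  cycle; as \<open>H\<close> without \<open>u\<close> is connected, a path leads from
  \<open>w\<close> back to a cycle vertex other than \<open>u\<close>, contradicting
  \<open>no_theta\<close>.\<close>

lemma (in graph) block_cycle:
  assumes G: "cactus G" and c: "cyclic (dominates G) c"
  shows "block G (G \<restriction> set c)"
proof -
  interpret adj: cactus_adj "verts G" "dominates G" using G by (rule cactus_adj_dominates)
  have sub: "subgraph (G \<restriction> set c) G"
    using induced_induce[OF cyclic_in_verts[OF c]] by (simp add: induced_subgraph_def)
  have False if H: "H \<noteq> G \<restriction> set c" "subgraph (G \<restriction> set c) H" "subgraph H G" "two_connected H" for H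
  proof -
    interpret H: graph H using H(4) by (simp add: two_connected_def)
    have HG: "u \<rightarrow> v" if "u \<rightarrow>\<^bsub>H\<^esub> v" for u v
      using adj_mono[OF that H(3)] .
    have cH: "set c \<subseteq> verts H" using H(2) by (simp add: subgraph_def)
    have th: "tail H = tail G" "head H = head G" using H(3) by (simp_all add: subgraph_def compatible_def)
    \<comment> \<open>On the same vertices \<open>H\<close> could have no further arcs, since the
      subgraph on \<open>set c\<close> is induced.\<close>
    have "verts H \<noteq> set c"
    proof
      assume v: "verts H = set c"
      have "arcs H \<subseteq> arcs (G \<restriction> set c)"
      proof
        fix a assume a: "a \<in> arcs H"
        have "a \<in> arcs G" using a H(3) unfolding subgraph_def by blast
        moreover have "tail G a \<in> set c" "head G a \<in> set c"
          using H.tail_in_verts[OF a] H.head_in_verts[OF a] by (simp_all only: th v)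
        ultimately show "a \<in> arcs (G \<restriction> set c)" by simp
      qed
      then have "arcs H = arcs (G \<restriction> set c)" using H(2) unfolding subgraph_def by blast
      then have "H = G \<restriction> set c" using v th by (intro pre_digraph.equality) simp_all
      then show False using H(1) by blast
    qed
    then obtain z where z: "z \<in> verts H" "z \<notin> set c" using cH by blast
    have "length c \<noteq> 0" using c by (auto simp: cyclic_def)
    then obtain x where x: "x \<in> set c" by (cases c) auto
    have "(dominates H)\<^sup>*\<^sup>* x z"
      using H(4) H.connected_iff_rtranclp x z cH by (auto simp: two_connected_def)
    then have "\<exists>u w. u \<in> set c \<and> w \<notin> set c \<and> u \<rightarrow>\<^bsub>H\<^esub> w" using x z(2)
      by (induction rule: converse_rtranclp_induct) auto
    then obtain u w where uw: "u \<in> set c" "w \<notin> set c" "u \<rightarrow>\<^bsub>H\<^esub> w" by blast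
    interpret D: graph "H.del_vert u" by (rule H.graph_del_vert)
    have dom: "x \<rightarrow>\<^bsub>H\<^esub> y \<and> x \<noteq> u \<and> y \<noteq> u" if "x \<rightarrow>\<^bsub>H.del_vert u\<^esub> y" for x y
      using that by (auto simp: arcs_ends_conv H.del_vert_simps)
    have "\<not> set c \<subseteq> {u}"
    proof
      assume "set c \<subseteq> {u}"
      then have "card (set c) \<le> 1" using card_mono[of "{u}" "set c"] by simp
      then show False using c by (simp add: cyclic_def distinct_card)
    qed
    then obtain y where y: "y \<in> set c" "y \<noteq> u" by blast
    have "w \<in> verts H" using H.adj_in_verts uw(3) by blast
    then have "(dominates (H.del_vert u))\<^sup>*\<^sup>* w y"
      using H(4) D.connected_iff_rtranclp y uw cH by (auto simp: two_connected_def H.del_vert_simps)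
    then obtain q t where q: "t \<in> set c" "q \<noteq> []" "hd q = w" "distinct q" "set q \<inter> set c = {}"
      "successively (dominates (H.del_vert u)) (q @ [t])"
      using first_entrance_path[OF _ uw(2) y(1)] by blast
    have "t \<noteq> u" using q(2,6) dom by (auto simp: successively_append_iff)
    moreover have "successively (dominates G) (q @ [t])"
      using q(6) by (rule successively_mono) (use HG dom in blast)
    then have "successively (dominates G) (u # q @ [t])"
      using q(2,3) HG[OF uw(3)] by (simp add: successively_Cons)
    ultimately show False using adj.no_theta[OF c uw(1) q(1) _ q(4,5)] q(2) by blast
  qed
  then have "max_subgraph two_connected (G \<restriction> set c)"
    using sub two_connected_induce_cycle[OF c] unfolding max_subgraph_def by blast
  then show ?thesis by (simp add: block_def)
qed

text \<open>The isomorphism sends a vertex to its position in \<open>c\<close> and an arc to the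
  pair of positions of its ends; \<open>cyclic_adj_iff\<close> identifies the image of the
  arcs.\<close>

lemma (in graph) cycle_iso_cycle_graph:
  assumes G: "cactus G" and c: "cyclic (dominates G) c"
  shows "digraph_iso (G \<restriction> set c) (with_proj (cycle_graph (length c)))"
proof -
  interpret adj: cactus_adj "verts G" "dominates G" using G by (rule cactus_adj_dominates)
  let ?n = "length c" and ?B = "G \<restriction> set c"
  define idx where "idx = inv_into {..<?n} ((!) c)"
  have bij: "bij_betw ((!) c) {..<?n} (set c)"
    using c by (auto simp: cyclic_def intro: bij_betw_nth)
  have idx: "idx (c ! i) = i" if "i < ?n" for i
    using that bij by (simp add: idx_def bij_betw_def inv_into_f_f)
  have idx_bij: "bij_betw idx (set c) {..<?n}" unfolding idx_def using bij by (rule bij_betw_inv_into)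
  have nth_idx: "c ! idx x = x" "idx x < ?n" if "x \<in> set c" for x
    using that idx by (auto simp: in_set_conv_nth)
  define f where "f = \<lparr>iso_verts = idx, iso_arcs = (\<lambda>a. (idx (tail G a), idx (head G a))),
    iso_head = snd, iso_tail = fst\<rparr>"
  have "inj_on (\<lambda>a. (idx (tail G a), idx (head G a))) (arcs ?B)"
  proof (rule inj_onI)
    fix a b assume ab: "a \<in> arcs ?B" "b \<in> arcs ?B"
      "(idx (tail G a), idx (head G a)) = (idx (tail G b), idx (head G b))"
    then have "tail G a = tail G b" "head G a = head G b"
      using idx_bij by (auto simp: bij_betw_def inj_on_def)
    \<comment> \<open>Only the ends of an arc enter its image, so injectivity rests on the absence
      of parallel arcs.\<close>
    then show "a = b" using no_multi_arcs[of a b] ab by (simp add: arc_to_ends_def)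
  qed
  then have "pre_digraph.digraph_isomorphism ?B f"
    using idx_bij wellformed_induce_subgraph
    by (auto simp: pre_digraph.digraph_isomorphism_def f_def bij_betw_def)
  moreover have arcs: "(\<lambda>a. (idx (tail G a), idx (head G a))) ` arcs ?B =
    {(i, j). i < ?n \<and> j < ?n \<and> (j = Suc i mod ?n \<or> i = Suc j mod ?n)}"
  proof (intro equalityI subsetI)
    fix e assume "e \<in> (\<lambda>a. (idx (tail G a), idx (head G a))) ` arcs ?B"
    then obtain a where a: "a \<in> arcs G" "tail G a \<in> set c" "head G a \<in> set c"
      "e = (idx (tail G a), idx (head G a))" by auto
    then have "c ! idx (tail G a) \<rightarrow> c ! idx (head G a)"
      using nth_idx in_arcs_imp_in_arcs_ends by simp
    then show "e \<in> {(i, j). i < ?n \<and> j < ?n \<and> (j = Suc i mod ?n \<or> i = Suc j mod ?n)}"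
      using adj.cyclic_adj_iff[OF c nth_idx(2) nth_idx(2)] a nth_idx(2) by auto
  next
    fix e assume "e \<in> {(i, j). i < ?n \<and> j < ?n \<and> (j = Suc i mod ?n \<or> i = Suc j mod ?n)}"
    then obtain i j where ij: "e = (i, j)" "i < ?n" "j < ?n" "c ! i \<rightarrow> c ! j"
      using adj.cyclic_adj_iff[OF c] by auto
    then obtain a where "a \<in> arcs G" "tail G a = c ! i" "head G a = c ! j" by auto
    then show "e \<in> (\<lambda>a. (idx (tail G a), idx (head G a))) ` arcs ?B"
      using ij idx by (intro image_eqI[of _ _ a]) auto
  qed
  moreover have "with_proj (cycle_graph ?n) = app_iso f ?B"
    using arcs idx_bij by (simp add: with_proj_def cycle_graph_def app_iso_def f_def bij_betw_def)
  ultimately show ?thesis unfolding digraph_iso_def by blast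
qed

text \<open>\<open>C5\<close> has diameter 2, checked pair by pair; \<open>k\<close> is the middle
  vertex.\<close>

lemma five_cycle_two_steps:
  fixes i j :: nat
  assumes "i < 5" "j < 5" "i \<noteq> j"
  shows "(j = Suc i mod 5 \<or> i = Suc j mod 5) \<or>
    (\<exists>k<5. (k = Suc i mod 5 \<or> i = Suc k mod 5) \<and> (j = Suc k mod 5 \<or> k = Suc j mod 5))"
proof -
  have less5: "k < 5 \<longleftrightarrow> k = 0 \<or> k = 1 \<or> k = 2 \<or> k = 3 \<or> k = 4" for k :: nat by linarith
  have ex5: "(\<exists>k<5. P k) \<longleftrightarrow> P 0 \<or> P 1 \<or> P 2 \<or> P 3 \<or> P 4" for P :: "nat \<Rightarrow> bool"
    unfolding less5 by blast
  show ?thesis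
    unfolding ex5 using assms[unfolded less5] by (elim disjE) simp_all
qed

lemma (in wf_digraph) subgraph_block:
  assumes "block G B"
  shows "subgraph B G"
proof (cases "max_subgraph two_connected B")
  case True
  then show ?thesis by (simp add: max_subgraph_def)
next
  case False
  then obtain a where "a \<in> arcs G" "B = G \<restriction> edge_of G a"
    using assms by (auto simp: block_def bridge_def)
  then show ?thesis using induced_induce[of "edge_of G a"] by (auto simp: edge_of_def)
qed

text \<open>The diameter of \<open>C5\<close> is pulled back along the isomorphism; this yields the
  clique for the lower bound 5.\<close>

lemma five_cycle_block_clique:
  assumes "digraph_iso B (with_proj (cycle_graph 5))"
  shows "card (verts B) = 5"
    and "x \<in> verts B \<Longrightarrow> y \<in> verts B \<Longrightarrow> x \<noteq> y \<Longrightarrow> at_distance_le2 (dominates B) x y"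
proof -
  obtain f where f: "pre_digraph.digraph_isomorphism B f"
    and eq: "with_proj (cycle_graph 5) = app_iso f B"
    using assms unfolding digraph_iso_def by blast
  have inj: "inj_on (iso_verts f) (verts B)" and wf: "wf_digraph B"
    using f by (auto simp: pre_digraph.digraph_isomorphism_def)
  have verts: "iso_verts f ` verts B = {..<5}"
    using arg_cong[OF eq, of verts] by (simp add: app_iso_def cycle_graph_def)
  then show "card (verts B) = 5" using card_image[OF inj] by simp
  have dom: "x \<rightarrow>\<^bsub>B\<^esub> y" if xy: "x \<in> verts B" "y \<in> verts B"
    "iso_verts f y = Suc (iso_verts f x) mod 5 \<or> iso_verts f x = Suc (iso_verts f y) mod 5" for x y
  proof -
    have "(iso_verts f x, iso_verts f y) \<in> arcs (with_proj (cycle_graph 5))"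
      using xy verts by (auto simp: cycle_graph_def)
    then obtain a where a: "a \<in> arcs B" "iso_arcs f a = (iso_verts f x, iso_verts f y)"
      unfolding eq by (auto simp: app_iso_def)
    \<comment> \<open>An arc of \<open>cycle_graph\<close> is the pair of its ends, so the tail and
      head maps of the isomorphism are the projections.\<close>
    have "iso_tail f = fst" "iso_head f = snd"
      using arg_cong[OF eq, of tail] arg_cong[OF eq, of head] by (simp_all add: app_iso_def)
    then have "iso_verts f (tail B a) = iso_verts f x" "iso_verts f (head B a) = iso_verts f y"
      using f a by (auto simp: pre_digraph.digraph_isomorphism_def)
    then have "tail B a = x" "head B a = y"
      using inj xy a wf by (auto dest: inj_onD wf_digraph.tail_in_verts wf_digraph.head_in_verts)
    then show ?thesis using a by (auto simp: arcs_ends_conv)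
  qed
  assume xy: "x \<in> verts B" "y \<in> verts B" "x \<noteq> y"
  then have "iso_verts f x < 5" "iso_verts f y < 5" "iso_verts f x \<noteq> iso_verts f y"
    using verts inj by (auto dest: inj_onD)
  then consider "iso_verts f y = Suc (iso_verts f x) mod 5 \<or> iso_verts f x = Suc (iso_verts f y) mod 5"
    | k where "k < 5" "k = Suc (iso_verts f x) mod 5 \<or> iso_verts f x = Suc k mod 5"
      "iso_verts f y = Suc k mod 5 \<or> k = Suc (iso_verts f y) mod 5"
    using five_cycle_two_steps by metis
  then show "at_distance_le2 (dominates B) x y"
  proof cases
    case 1
    then show ?thesis using dom xy unfolding at_distance_le2_def by blast
  next
    case 2
    then obtain z where "z \<in> verts B" "k = iso_verts f z" using verts by (metis imageE lessThan_iff)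
    then have "x \<rightarrow>\<^bsub>B\<^esub> z" "z \<rightarrow>\<^bsub>B\<^esub> y" using dom 2 xy by blast+
    then show ?thesis using xy(3) unfolding at_distance_le2_def by blast
  qed
qed

section \<open>Distance, colourings of the square, and the two colouring numbers\<close>

lemma (in wf_digraph) distance_at_distance_le2:
  assumes uv: "u \<in> verts G" "v \<in> verts G"
  shows "1 \<le> distance G u v \<and> distance G u v \<le> 2 \<longleftrightarrow> at_distance_le2 (dominates G) u v"
proof -
  have cost: "awalk_cost (\<lambda>_. 1) p = real (length p)" for p :: "'b list"
    by (induction p) auto
  have le: "distance G u v \<le> ereal (real (length p))" if "awalk u p v" for p
    using min_cost_le_walk_cost[OF that, of "\<lambda>_. 1"] by (simp add: distance_def cost)
  show ?thesis
  proof
    assume d: "1 \<le> distance G u v \<and> distance G u v \<le> 2"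
    \<comment> \<open>The distance is an infimum of walk lengths. The strict bound 3 provides an
      actual walk below it, which has at most two arcs because lengths are integers.\<close>
    then have "distance G u v < 3" by (auto elim: le_less_trans)
    then obtain p where p: "awalk u p v" "ereal (real (length p)) < 3"
      unfolding distance_def \<mu>_def cost by (auto simp: INF_less_iff)
    then have len: "length p \<le> 2" by simp
    have "u \<noteq> v"
    proof
      assume "u = v"
      \<comment> \<open>The empty walk has cost 0.\<close>
      then have "distance G u v \<le> 0" using le[of "[]"] uv by (simp add: awalk_Nil_iff zero_ereal_def)
      then have "(1::ereal) \<le> 0" using d by (blast intro: order_trans)
      then show False by simp
    qed
    moreover have "u \<rightarrow> v \<or> (\<exists>z. u \<rightarrow> z \<and> z \<rightarrow> v)"
    proof -
      have "p \<noteq> []" using p(1) \<open>u \<noteq> v\<close> by (auto simp: awalk_Nil_iff)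
      then obtain a p' where a: "p = a # p'" by (cases p) auto
      show ?thesis
      proof (cases p')
        case Nil
        then have "a \<in> arcs G" "tail G a = u" "head G a = v" using p(1) a by (auto simp: awalk_simps)
        then show ?thesis using in_arcs_imp_in_arcs_ends[of a] by simp
      next
        case (Cons b p'')
        then have "p'' = []" using len a by simp
        then have "a \<in> arcs G" "tail G a = u" "b \<in> arcs G" "tail G b = head G a" "head G b = v"
          using p(1) a Cons by (auto simp: awalk_simps)
        then show ?thesis using in_arcs_imp_in_arcs_ends[of a] in_arcs_imp_in_arcs_ends[of b] by auto
      qed
    qed
    ultimately show "at_distance_le2 (dominates G) u v" by (simp add: at_distance_le2_def)
  next
    assume n: "at_distance_le2 (dominates G) u v"
    then have "u \<noteq> v" by (simp add: at_distance_le2_def)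
    have "1 \<le> distance G u v"
      unfolding distance_def \<mu>_def cost
    proof (rule INF_greatest)
      fix p assume "p \<in> {p. awalk u p v}"
      then have "p \<noteq> []" using \<open>u \<noteq> v\<close> by (auto simp: awalk_Nil_iff)
      then show "1 \<le> ereal (real (length p))" by (cases p) auto
    qed
    moreover have "\<exists>p. awalk u p v \<and> length p \<le> 2"
    proof -
      consider "u \<rightarrow> v" | z where "u \<rightarrow> z" "z \<rightarrow> v" using n by (auto simp: at_distance_le2_def)
      then show ?thesis
      proof cases
        case 1
        then obtain a where "a \<in> arcs G" "tail G a = u" "head G a = v" by auto
        then show ?thesis using uv by (intro exI[of _ "[a]"]) (auto simp: awalk_simps)
      next
        case 2
        obtain a where "a \<in> arcs G" "tail G a = u" "head G a = z" using 2(1) by auto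
        moreover obtain b where "b \<in> arcs G" "tail G b = z" "head G b = v" using 2(2) by auto
        ultimately show ?thesis using uv by (intro exI[of _ "[a, b]"]) (auto simp: awalk_simps)
      qed
    qed
    then obtain p where p: "awalk u p v" "length p \<le> 2" by blast
    have "distance G u v \<le> 2"
      by (rule order_trans[OF le[OF p(1)]]) (use p(2) in simp)
    ultimately show "1 \<le> distance G u v \<and> distance G u v \<le> 2" by blast
  qed
qed

lemma (in wf_digraph) proper_coloring_graph_square:
  "proper_coloring (with_proj (graph_square G)) c \<longleftrightarrow>
    (\<forall>u\<in>verts G. \<forall>v\<in>verts G. at_distance_le2 (dominates G) u v \<longrightarrow> c u \<noteq> c v)"
  using distance_at_distance_le2 by (auto simp: proper_coloring_def graph_square_def)

lemma (in nomulti_digraph) out_degree_eq_card: "out_degree G v = card {y. v \<rightarrow> y}"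
proof -
  have "inj_on (head G) (out_arcs G v)"
    by (auto simp: inj_on_def out_arcs_def arc_to_ends_def intro: no_multi_arcs)
  moreover have "head G ` out_arcs G v = {y. v \<rightarrow> y}"
    by (auto simp: out_arcs_def arcs_ends_conv)
  ultimately show ?thesis unfolding out_degree_def by (metis card_image)
qed

text \<open>Constant lists turn choosability into colourability, and the clique forces
  \<open>K\<close> colours; this bounds both numbers below, while choosability with \<open>K\<close>
  bounds both above.\<close>

lemma chromatic_choice_number_eqI:
  assumes K: "choosable H K" and Q: "Q \<subseteq> verts H" "card Q = K"
    and clique: "\<And>c x y. proper_coloring H c \<Longrightarrow> x \<in> Q \<Longrightarrow> y \<in> Q \<Longrightarrow> x \<noteq> y \<Longrightarrow> c x \<noteq> c y"
  shows "chromatic_number H = K" "choice_number H = K"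
proof -
  have colorable: "\<exists>c. c ` verts H \<subseteq> {..<k} \<and> proper_coloring H c" if "choosable H k" for k
    using that[unfolded choosable_def, rule_format, of "\<lambda>_. {..<k}"] by auto
  have lower: "K \<le> k" if c: "c ` verts H \<subseteq> {..<k}" "proper_coloring H c" for c k
  proof -
    have "inj_on c Q" using clique[OF c(2)] by (meson inj_onI)
    then have "card Q \<le> card {..<k}" using c(1) Q(1) by (intro card_inj_on_le) auto
    then show ?thesis using Q(2) by simp
  qed
  show "chromatic_number H = K"
    unfolding chromatic_number_def
    by (rule Least_equality) (use colorable[OF K] lower in blast)+
  show "choice_number H = K"
    unfolding choice_number_def
    by (rule Least_equality) (use K colorable lower in blast)+
qed

theorem theorem1:
  fixes G :: "('a, 'b) pre_digraph"
  assumes "cactus G" and "max_degree G = 3"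
  shows "(\<not> (\<exists>B. block G B \<and> digraph_iso B (with_proj (cycle_graph 5))) \<longrightarrow>
           chromatic_number (with_proj (graph_square G)) = 4 \<and>
           choice_number (with_proj (graph_square G)) = 4) \<and>
         ((\<exists>B. block G B \<and> digraph_iso B (with_proj (cycle_graph 5))) \<longrightarrow>
           chromatic_number (with_proj (graph_square G)) = 5 \<and>
           choice_number (with_proj (graph_square G)) = 5)"
proof -
  interpret graph G using assms(1) by (simp add: cactus_def)
  interpret adj: cactus_adj "verts G" "dominates G" using assms(1) by (rule cactus_adj_dominates)
  let ?H = "with_proj (graph_square G)"
  have conn: "verts G \<noteq> {}" "\<And>x y. x \<in> verts G \<Longrightarrow> y \<in> verts G \<Longrightarrow> (dominates G)\<^sup>*\<^sup>* x y"
    using assms(1) by (auto simp: cactus_def connected_iff_rtranclp)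
  have verts_H: "verts ?H = verts G" by (simp add: graph_square_def)
  have deg: "card {y. x \<rightarrow>\<^bsub>G\<^esub> y} \<le> 3" for x
  proof (cases "x \<in> verts G")
    case True
    then have "out_degree G x \<le> max_degree G" unfolding max_degree_def by (intro Max_ge) auto
    then show ?thesis using assms(2) out_degree_eq_card by simp
  next
    case False
    then have "{y. x \<rightarrow>\<^bsub>G\<^esub> y} = {}" using adj_in_verts by blast
    then show ?thesis by (metis card.empty le0)
  qed
  have choosable: "choosable ?H K"
    if K: "4 \<le> K" "\<And>c. cyclic (dominates G) c \<Longrightarrow> length c = 5 \<Longrightarrow> 5 \<le> K" for K
    unfolding choosable_def verts_H proper_coloring_graph_square
  proof (intro allI impI)
    fix L :: "'a \<Rightarrow> nat set" assume L: "\<forall>v\<in>verts G. finite (L v) \<and> K \<le> card (L v)"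
    then obtain f where "adj.square_list_coloring L (verts G) f"
      using adj.square_list_colorable[where L = L and K = K] conn(2) K deg by blast
    then show "\<exists>c. (\<forall>v\<in>verts G. c v \<in> L v) \<and>
        (\<forall>u\<in>verts G. \<forall>v\<in>verts G. at_distance_le2 (dominates G) u v \<longrightarrow> c u \<noteq> c v)"
      unfolding adj.square_list_coloring_def by blast
  qed
  \<comment> \<open>Each part now only needs a clique of size \<open>K\<close> in the square and the
    condition on 5-cycles.\<close>
  have numbers: "chromatic_number ?H = K \<and> choice_number ?H = K"
    if K: "4 \<le> K" "\<And>c. cyclic (dominates G) c \<Longrightarrow> length c = 5 \<Longrightarrow> 5 \<le> K"
      and Q: "Q \<subseteq> verts G" "card Q = K"
        "\<And>x y. x \<in> Q \<Longrightarrow> y \<in> Q \<Longrightarrow> x \<noteq> y \<Longrightarrow> at_distance_le2 (dominates G) x y" for K Q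
  proof -
    have "c x \<noteq> c y" if "proper_coloring ?H c" "x \<in> Q" "y \<in> Q" "x \<noteq> y" for c x y
      using that Q unfolding proper_coloring_graph_square by blast
    moreover have "choosable ?H K" using choosable K by blast
    ultimately show ?thesis
      using chromatic_choice_number_eqI[where Q = Q and K = K and H = ?H] Q(1,2) verts_H by blast
  qed
  show ?thesis
  proof (intro conjI impI)
    assume no: "\<not> (\<exists>B. block G B \<and> digraph_iso B (with_proj (cycle_graph 5)))"
    \<comment> \<open>A 5-cycle would be a block isomorphic to \<open>C5\<close>, so none exists and
      the false bound holds vacuously.\<close>
    have no5: "5 \<le> (4::nat)" if c: "cyclic (dominates G) c" "length c = 5" for c
      using no block_cycle[OF assms(1) c(1)] cycle_iso_cycle_graph[OF assms(1) c(1)] c(2) by auto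
    have "max_degree G \<in> out_degree G ` verts G"
      unfolding max_degree_def using conn(1) by (intro Max_in) auto
    then obtain v where v: "v \<in> verts G" "card {y. v \<rightarrow>\<^bsub>G\<^esub> y} = 3"
      using assms(2) out_degree_eq_card by auto
    \<comment> \<open>A vertex of maximum degree and its three neighbours are pairwise at distance
      at most two.\<close>
    let ?Q = "insert v {y. v \<rightarrow>\<^bsub>G\<^esub> y}"
    have "?Q \<subseteq> verts G" using v adj_in_verts by blast
    moreover have "card ?Q = 4"
      using v adj.neighbours_finite[of v] adj.adj_irrefl by (simp add: card_insert_if)
    moreover have "at_distance_le2 (dominates G) x y" if "x \<in> ?Q" "y \<in> ?Q" "x \<noteq> y" for x y
      using that adj.adj_sym unfolding at_distance_le2_def by blast
    ultimately have "chromatic_number ?H = 4 \<and> choice_number ?H = 4"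
      using numbers[of 4 ?Q] no5 by blast
    then show "chromatic_number ?H = 4" "choice_number ?H = 4" by blast+
  next
    assume "\<exists>B. block G B \<and> digraph_iso B (with_proj (cycle_graph 5))"
    then obtain B where B: "block G B" "digraph_iso B (with_proj (cycle_graph 5))" by blast
    have sub: "subgraph B G" using B(1) by (rule subgraph_block)
    \<comment> \<open>Short paths in the block are paths in \<open>G\<close>. For
      \<open>K = 5\<close> the condition on 5-cycles is trivial.\<close>
    have "at_distance_le2 (dominates G) x y" if "x \<in> verts B" "y \<in> verts B" "x \<noteq> y" for x y
      using five_cycle_block_clique(2)[OF B(2) that] adj_mono[OF _ sub]
      unfolding at_distance_le2_def by blast
    then have "chromatic_number ?H = 5 \<and> choice_number ?H = 5"
      using numbers[of 5 "verts B"] sub five_cycle_block_clique(1)[OF B(2)]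
      by (auto simp: subgraph_def)
    then show "chromatic_number ?H = 5" "choice_number ?H = 5" by blast+
  qed
qed

end
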